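(* Let $\Omega\subset\mathbb{C}$ be a bounded simply connected domain, let $\mu$ be a positive measure on $\Omega$, and let $0<p<q<\infty$. Then $\mu$ is a $q$-Carleson measure for $\mathcal{H}^p(\Omega)$ if and only if there is a constant $c>0$ such that $\mu(B(z,r))\le c\, r^{q/p}$ for all Whitney balls $B(z,r)\subset\Omega$.
   Context: For $z\in\Omega$, $\delta_\Omega(z)=\operatorname{dist}(z,\partial\Omega)$. A Whitney ball is a disc $B(z,r)\subset\Omega$ with $c_0\,\delta_\Omega(z)\le r\le \tfrac12\delta_\Omega(z)$, where $c_0\in(0,1/2]$ is a fixed constant. $\mathbb{D}$ is the unit disc and $\mathcal{H}^p(\mathbb{D})$ the classical Hardy space of analytic $g$ on $\mathbb{D}$ with $\|g\|_{\mathcal{H}^p}^p=\sup_{0<r<1}\frac{1}{2\pi}\int_0^{2\pi}|g(re^{i\theta})|^p\,d\theta<\infty$. A positive measure $\nu$ on $\mathbb{D}$ is a $q$-Carleson measure for $\mathcal{H}^p(\mathbb{D})$ if there is $C>0$ with $\left(\int_{\mathbb{D}}|g|^q\,d\nu\right)^{1/q}\le C\|g\|_{\mathcal{H}^p}$ for all $g\in\mathcal{H}^p(\mathbb{D})$. When $\partial\Omega$ is rectifiable, $\mathcal{H}^p(\Omega)$ is the space of analytic $f$ on $\Omega$ with $\int_{\partial\Omega}|f|^p\,ds<\infty$ ($ds$ = arc length), and $\mu$ is a $q$-Carleson measure for $\mathcal{H}^p(\Omega)$ if $\left(\int_\Omega|f|^q\,d\mu\right)^{1/q}\le C\left(\int_{\partial\Omega}|f|^p\,ds\right)^{1/p}$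 for all such $f$. For a general bounded simply connected $\Omega$ (no rectifiability assumed), fix a conformal map $\varphi:\mathbb{D}\to\Omega$, let $\varphi^*(\mu)$ be the pullback measure $\varphi^*(\mu)(E)=\mu(\varphi(E))$ for $E\subset\mathbb{D}$, and define $d\nu=|\varphi'|^{-q/p}\,d\varphi^*(\mu)$ on $\mathbb{D}$; then $\mu$ is called a $q$-Carleson measure for $\mathcal{H}^p(\Omega)$ if and only if $\nu$ is a $q$-Carleson measure for $\mathcal{H}^p(\mathbb{D})$ (this agrees with the previous definition in the rectifiable case and does not depend on the choice of $\varphi$). *)

theory Defs
  imports "HOL-Complex_Analysis.Complex_Analysis"
begin

definition bdist :: "complex set \<Rightarrow> complex \<Rightarrow> real" where
  "bdist \<Omega> z = infdist z (frontier \<Omega>)"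

definition whitney_ball :: "real \<Rightarrow> complex set \<Rightarrow> complex \<Rightarrow> real \<Rightarrow> bool" where
  "whitney_ball c0 \<Omega> z r \<longleftrightarrow> z \<in> \<Omega> \<and> ball z r \<subseteq> \<Omega> \<and>
      c0 * bdist \<Omega> z \<le> r \<and> r \<le> bdist \<Omega> z / 2"

definition hardy_disc_pnorm :: "real \<Rightarrow> (complex \<Rightarrow> complex) \<Rightarrow> ennreal" where
  "hardy_disc_pnorm p g =
     (SUP r\<in>{0<..<1}. ennreal (1 / (2 * pi)) *
        (\<integral>\<^sup>+ \<theta>\<in>{0..2*pi}. ennreal (norm (g (complex_of_real r * cis \<theta>)) powr p) \<partial>lborel))"

definition in_hardy_disc :: "real \<Rightarrow> (complex \<Rightarrow> complex) \<Rightarrow> bool" where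
  "in_hardy_disc p g \<longleftrightarrow> g holomorphic_on ball 0 1 \<and> hardy_disc_pnorm p g < \<infinity>"

text \<open>q-Carleson measure for H^p(D):
  (\<integral> |g|^q d\<nu>)^{1/q} \<le> C \<parallel>g\<parallel>_{H^p}, written after raising both sides to the power q.\<close>
definition carleson_disc :: "real \<Rightarrow> real \<Rightarrow> complex measure \<Rightarrow> bool" where
  "carleson_disc p q \<nu> \<longleftrightarrow> (\<exists>C>0. \<forall>g. in_hardy_disc p g \<longrightarrow>
      (\<integral>\<^sup>+ w. ennreal (norm (g w) powr q) \<partial>\<nu>)
        \<le> ennreal ((C * enn2real (hardy_disc_pnorm p g) powr (1 / p)) powr q))"

definition pullback :: "(complex \<Rightarrow> complex) \<Rightarrow> complex measure \<Rightarrow> complex measure" where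
  "pullback \<phi> \<mu> = measure_of (ball 0 1) (sets (restrict_space borel (ball 0 1)))
      (\<lambda>E. emeasure \<mu> (\<phi> ` E))"

definition carleson_nu :: "real \<Rightarrow> real \<Rightarrow> (complex \<Rightarrow> complex) \<Rightarrow> complex measure \<Rightarrow> complex measure" where
  "carleson_nu p q \<phi> \<mu> =
     density (pullback \<phi> \<mu>) (\<lambda>w. ennreal (norm (deriv \<phi> w) powr (- q / p)))"

text \<open>\<mu> is a q-Carleson measure for H^p(\<Omega>), relative to the conformal map \<phi> : D \<rightarrow> \<Omega>.\<close>
definition carleson_domain :: "real \<Rightarrow> real \<Rightarrow> (complex \<Rightarrow> complex) \<Rightarrow> complex measure \<Rightarrow> bool" where
  "carleson_domain p q \<phi> \<mu> \<longleftrightarrow> carleson_disc p q (carleson_nu p q \<phi> \<mu>)"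

end

theory Submission
  imports Defs
begin

text \<open>
Koebe distortion: if \<open>F\<close> is univalent on a disc of radius \<open>R\<close> and omits \<open>\<omega>\<close>, then the image of
\<open>log (F - \<omega>)\<close> is disjoint from its translate by \<open>2\<pi>\<i>\<close>, so it contains no disc of radius larger than \<open>\<pi>\<close>;
Bloch's theorem then bounds \<open>R |F'| / |F - \<omega>|\<close> by \<open>12\<pi>\<close> at the centre. Applied to \<open>\<phi>\<close> and to \<open>\<phi>\<inverse>\<close>, this gives
\<open>|\<phi>'(w)| (1 - |w|) \<approx> dist (\<phi> w, \<partial>\<Omega>)\<close>, and the Whitney condition for \<open>\<mu>\<close> turns into the bound
\<open>\<nu>(B(w, \<kappa>(1 - |w|))) \<le> c (1 - |w|)^s\<close>, \<open>s = q/p > 1\<close>, in the disc. Its necessity follows by testing the Carleson inequality on the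
\<open>p\<close>-th roots of the kernels \<open>(1 - |a|^2) / (1 - cnj a w)^2\<close>.

Sufficiency: let \<open>u = |g|^(p/2)\<close>, with boundary values \<open>f\<close> on a circle close to the unit circle. Dividing out the zeros
by a finite Blaschke product shows that \<open>u\<close> is dominated by the Poisson integral of \<open>f\<close>, and
\<open>u^2 \<le> 8N / (1 - |w|)\<close> with \<open>N\<close> the \<open>p\<close>-th power of the Hardy norm. The part of \<open>f\<close> below \<open>u(w)/2\<close> contributes at most
half of \<open>u(w)\<close>, so \<open>u^(2s)\<close> at \<open>w\<close> is at most twice the Poisson integral at \<open>w\<close> of
\<open>f min(2f, sqrt(8N / (1 - |w|)))^(2s-1)\<close>.
After integrating against \<open>\<nu>\<close> and exchanging integrals, the annulus \<open>1 - |w| \<approx> \<tau>\<close> contributes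
\<open>\<tau>^(s-1)\<close> times the value of the minimum there, and the sum over a geometric sequence of \<open>\<tau>\<close> is
\<open>O(N^(s-1) f)\<close>. What remains is \<open>N^(s-1)\<close> times the integral of \<open>f^2\<close>, that is, \<open>O(N^s)\<close>.
\<close>

section \<open>Distortion of univalent functions\<close>

text \<open>A covering theorem with \<open>1 / (12 * pi)\<close> in place of Koebe's 1/4. An omitted
  value \<open>\<omega>\<close> gives a branch \<open>L\<close> of log (F - \<omega>) with |L'(a)| =
  |F'(a)| / |F(a) - \<omega>|. Bloch's theorem puts a disc of radius R |L'(a)| / 12 into the image
  of \<open>L\<close>, and injectivity of \<open>F\<close> forbids a radius above pi.\<close>

lemma koebe_ball_subset_image:
  assumes hol: "F holomorphic_on ball a R" and inj: "inj_on F (ball a R)" and R: "0 < R"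
  shows "ball (F a) (R * norm (deriv F a) / (12 * pi)) \<subseteq> F ` ball a R"
proof
  fix \<omega> assume \<omega>: "\<omega> \<in> ball (F a) (R * norm (deriv F a) / (12 * pi))"
  show "\<omega> \<in> F ` ball a R"
  proof (rule ccontr)
    assume nin: "\<omega> \<notin> F ` ball a R"
    have nz: "F z - \<omega> \<noteq> 0" if "z \<in> ball a R" for z
      using nin that by auto
    have hol': "(\<lambda>z. F z - \<omega>) holomorphic_on ball a R"
      by (intro holomorphic_intros hol)
    obtain L where L: "L holomorphic_on ball a R" and exp_L: "\<And>z. z \<in> ball a R \<Longrightarrow> exp (L z) = F z - \<omega>"
      using holomorphic_logarithm_exists[of "ball a R" "\<lambda>z. F z - \<omega>" a] hol' nz R
      by (metis centre_in_ball convex_ball open_ball)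
    have a: "a \<in> ball a R" using R by simp
    have "((\<lambda>z. exp (L z)) has_field_derivative exp (L a) * deriv L a) (at a)"
      using L a holomorphic_derivI[OF L open_ball a] by (auto intro!: derivative_eq_intros)
    then have "((\<lambda>z. F z - \<omega>) has_field_derivative exp (L a) * deriv L a) (at a)"
      using DERIV_cong_ev[OF refl _ refl, of "\<lambda>z. exp (L z)" "\<lambda>z. F z - \<omega>" a]
        eventually_nhds_in_open[OF open_ball a] exp_L by (smt (verit) eventually_mono)
    moreover have "((\<lambda>z. F z - \<omega>) has_field_derivative deriv F a) (at a)"
      using holomorphic_derivI[OF hol open_ball a] by (auto intro!: derivative_eq_intros)
    ultimately have "deriv F a = exp (L a) * deriv L a"
      using DERIV_unique by blast
    then have nd: "norm (deriv F a) = norm (F a - \<omega>) * norm (deriv L a)"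
      by (simp add: exp_L[OF a] norm_mult)
    have pos: "norm (F a - \<omega>) > 0" using nz[OF a] by simp
    \<comment> \<open>The assumed closeness of \<open>\<omega>\<close> to \<open>F a\<close> makes
      |L'(a)| so large that the Bloch disc has radius above pi.\<close>
    have "norm (F a - \<omega>) * (12 * pi) < R * norm (deriv F a)"
      using \<omega> by (simp add: dist_norm field_simps)
    then have "norm (F a - \<omega>) * (12 * pi) < norm (F a - \<omega>) * (R * norm (deriv L a))"
      by (simp add: nd mult_ac)
    then have gt: "pi < R * norm (deriv L a) / 12"
      using pos by simp
    obtain b where b: "ball b (R * norm (deriv L a) / 12) \<subseteq> L ` ball a R"
      using Bloch[OF L R order_refl] by blast
    \<comment> \<open>Two points of the Bloch disc that differ by 2 pi in the imaginary direction:
      their exponentials agree, so \<open>F\<close> agrees at their preimages.\<close>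
    have "b + \<i> * pi \<in> L ` ball a R" "b - \<i> * pi \<in> L ` ball a R"
      using gt by (auto intro!: subsetD[OF b] simp: dist_norm norm_mult)
    then obtain x y where x: "x \<in> ball a R" "L x = b + \<i> * pi" and y: "y \<in> ball a R" "L y = b - \<i> * pi"
      by (metis imageE)
    have "exp (L x) = exp (L y)"
      by (simp add: x(2) y(2) exp_add exp_diff)
    then have "F x = F y" using exp_L x(1) y(1) by simp
    then have "x = y" using inj x(1) y(1) by (meson inj_onD)
    then have "b + \<i> * pi = b - \<i> * pi" using x(2) y(2) by simp
    then show False by (simp add: complex_eq_iff)
  qed
qed

text \<open>After moving \<open>f z\<close> to 0 by a Moebius map and rescaling the ball to the unit
  disc, this is Schwarz's lemma at a point of modulus below 1/2: the pseudohyperbolic distance of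
  \<open>f x\<close> and \<open>f z\<close> is at most 1/2, stated without the quotient.\<close>

lemma Schwarz_Pick_half_ball:
  assumes hol: "f holomorphic_on ball z d" and d: "0 < d"
    and lt: "\<And>x. x \<in> ball z d \<Longrightarrow> norm (f x) < 1" and x: "x \<in> ball z (d / 2)"
  shows "norm (f x - f z) \<le> norm (1 - cnj (f z) * f x) / 2"
proof -
  define h where "h = (\<lambda>\<zeta>. Moebius_function 0 (f z) (f (z + of_real d * \<zeta>)))"
  have fz: "norm (f z) < 1" using lt d by simp
  have mem: "z + of_real d * \<zeta> \<in> ball z d" if "norm \<zeta> < 1" for \<zeta>
    using that d by (simp add: dist_norm norm_mult)
  have "f \<circ> (\<lambda>\<zeta>. z + of_real d * \<zeta>) holomorphic_on ball 0 1"
    by (rule holomorphic_on_compose_gen[OF _ hol]) (use mem in \<open>auto intro!: holomorphic_intros\<close>)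
  then have "Moebius_function 0 (f z) \<circ> (f \<circ> (\<lambda>\<zeta>. z + of_real d * \<zeta>)) holomorphic_on ball 0 1"
    by (rule holomorphic_on_compose_gen[OF _ Moebius_function_holomorphic[OF fz]]) (use mem lt in auto)
  then have 1: "h holomorphic_on ball 0 1"
    by (simp add: h_def o_def)
  have 2: "h 0 = 0" by (simp add: h_def Moebius_function_eq_zero)
  have 3: "norm (h \<zeta>) < 1" if "norm \<zeta> < 1" for \<zeta>
    unfolding h_def by (rule Moebius_function_norm_lt_1[OF fz]) (use lt mem that in auto)
  define \<xi> where "\<xi> = (x - z) / of_real d"
  have \<xi>: "norm \<xi> < 1 / 2" "z + of_real d * \<xi> = x"
    using x d by (auto simp: \<xi>_def norm_divide dist_norm norm_minus_commute field_simps)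
  have "norm (h \<xi>) \<le> 1 / 2"
    using Schwarz_Lemma(1)[OF 1 2 3, of \<xi>] \<xi> by simp
  then have *: "norm (f x - f z) / norm (1 - cnj (f z) * f x) \<le> 1/2"
    by (simp add: h_def \<xi> Moebius_function_simple norm_divide)
  have "norm (cnj (f z) * f x) < 1"
    using fz lt[of x] x d mult_strict_mono'[of "norm (f z)" 1 "norm (f x)" 1]
    by (auto simp: norm_mult)
  then have "1 - cnj (f z) * f x \<noteq> 0" by force
  then show ?thesis using * by (simp add: divide_simps)
qed

section \<open>Distance to the boundary\<close>

lemma bdist_pos:
  assumes "open \<Omega>" "bounded \<Omega>" "z \<in> \<Omega>"
  shows "0 < bdist \<Omega> z"
proof -
  \<comment> \<open>Boundedness makes the frontier nonempty; \<open>infdist\<close> to the empty set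
    would be 0.\<close>
  have "frontier \<Omega> \<noteq> {}"
    using assms not_bounded_UNIV by (auto simp: frontier_eq_empty)
  moreover have "z \<notin> frontier \<Omega>"
    using assms by (simp add: frontier_def interior_open)
  ultimately show ?thesis
    unfolding bdist_def by (metis frontier_closed infdist_pos_not_in_closed)
qed

text \<open>A ball is connected, so if it is centred in \<open>\<Omega>\<close> and leaves it, it
  meets the frontier, at a distance below the infimum.\<close>

lemma ball_bdist_subset:
  assumes "z \<in> \<Omega>"
  shows "ball z (bdist \<Omega> z) \<subseteq> \<Omega>"
proof (rule ccontr)
  assume "\<not> ?thesis"
  then have ne: "ball z (bdist \<Omega> z) - \<Omega> \<noteq> {}" by blast
  then have "z \<in> ball z (bdist \<Omega> z)"
    by (metis ball_eq_empty centre_in_ball empty_Diff not_le)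
  then have "ball z (bdist \<Omega> z) \<inter> frontier \<Omega> \<noteq> {}"
    using connected_Int_frontier[OF connected_ball, of z "bdist \<Omega> z" \<Omega>] assms ne by blast
  then obtain x where "x \<in> frontier \<Omega>" "dist z x < bdist \<Omega> z" by auto
  then show False
    using infdist_le[of x "frontier \<Omega>" z] by (simp add: bdist_def)
qed

lemma le_bdist:
  assumes "open \<Omega>" "bounded \<Omega>" "\<Omega> \<noteq> {}" "ball z r \<subseteq> \<Omega>"
  shows "r \<le> bdist \<Omega> z"
proof -
  have ne: "frontier \<Omega> \<noteq> {}"
    using assms not_bounded_UNIV by (auto simp: frontier_eq_empty)
  have "r \<le> dist z x" if "x \<in> frontier \<Omega>" for x
  proof (rule ccontr)
    assume "\<not> ?thesis"
    then have "x \<in> \<Omega>" using assms(4) by auto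
    then show False using that assms(1) by (simp add: frontier_def interior_open)
  qed
  then show ?thesis
    unfolding bdist_def infdist_def using ne by (auto intro!: cINF_greatest)
qed

lemma bdist_triangle: "bdist \<Omega> x \<le> bdist \<Omega> y + dist x y"
  unfolding bdist_def by (rule infdist_triangle)

text \<open>The covered ball lies in \<open>\<Omega>\<close>, so its radius is at most the distance
  to the frontier. Applied both to \<open>\<phi>\<close> with target \<open>\<Omega>\<close> and to
  \<open>\<psi>\<close> with target the unit disc.\<close>

lemma koebe_deriv_le_bdist:
  assumes hol: "F holomorphic_on ball a R" and inj: "inj_on F (ball a R)" and R: "0 < R"
    and sub: "F ` ball a R \<subseteq> \<Omega>" and "open \<Omega>" "bounded \<Omega>"
  shows "R * norm (deriv F a) \<le> 12 * pi * bdist \<Omega> (F a)"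
proof -
  have "ball (F a) (R * norm (deriv F a) / (12 * pi)) \<subseteq> \<Omega>"
    using koebe_ball_subset_image[OF hol inj R] sub by blast
  moreover have "\<Omega> \<noteq> {}" using sub R by (metis centre_in_ball empty_iff image_subset_iff)
  ultimately have "R * norm (deriv F a) / (12 * pi) \<le> bdist \<Omega> (F a)"
    by (intro le_bdist assms)
  then show ?thesis by (simp add: field_simps)
qed

lemma bdist_unit_ball_le:
  assumes "w \<in> ball 0 1"
  shows "bdist (ball 0 1) (w::complex) \<le> 1 - norm w"
proof -
  \<comment> \<open>The radial projection to the unit circle is a nearest boundary point; at the
    origin any boundary point serves, here 1.\<close>
  define x where "x = (if w = 0 then 1 else w / of_real (norm w))"
  have "x \<in> frontier (ball 0 1)" by (simp add: x_def norm_divide)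
  moreover have "dist w x = 1 - norm w"
  proof (cases "w = 0")
    case False
    then have "x - w = of_real (1 / norm w - 1) * w" by (simp add: x_def field_simps)
    then have "norm (x - w) = \<bar>1 / norm w - 1\<bar> * norm w" by (simp only: norm_mult norm_of_real)
    also have "\<dots> = 1 - norm w" using False assms by (simp add: field_simps)
    finally show ?thesis by (simp add: dist_norm norm_minus_commute)
  qed (simp add: x_def)
  ultimately show ?thesis
    unfolding bdist_def by (metis infdist_le)
qed

section \<open>The conformal map and its inverse\<close>

locale conformal_disc =
  fixes \<Omega> :: "complex set" and \<phi> :: "complex \<Rightarrow> complex"
  assumes open_dom: "open \<Omega>" and bounded_dom: "bounded \<Omega>"
    and hol: "\<phi> holomorphic_on ball 0 1" and bij: "bij_betw \<phi> (ball 0 1) \<Omega>"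
begin

definition \<psi> :: "complex \<Rightarrow> complex" where "\<psi> = inv_into (ball 0 1) \<phi>"

abbreviation \<delta> :: "complex \<Rightarrow> real" where "\<delta> \<equiv> bdist \<Omega>"

lemma inj: "inj_on \<phi> (ball 0 1)" and image: "\<phi> ` ball 0 1 = \<Omega>"
  using bij by (auto simp: bij_betw_def)

lemma phi_in: "norm w < 1 \<Longrightarrow> \<phi> w \<in> \<Omega>"
  using image by auto

lemma psi_phi: "norm w < 1 \<Longrightarrow> \<psi> (\<phi> w) = w"
  unfolding \<psi>_def using inv_into_f_f[OF inj] by simp

lemma phi_psi: "z \<in> \<Omega> \<Longrightarrow> \<phi> (\<psi> z) = z"
  unfolding \<psi>_def using f_inv_into_f[of z \<phi> "ball 0 1"] image by simp

lemma psi_in: "z \<in> \<Omega> \<Longrightarrow> norm (\<psi> z) < 1"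
  unfolding \<psi>_def using inv_into_into[of z \<phi> "ball 0 1"] image by simp

lemma inj_psi: "inj_on \<psi> \<Omega>"
  by (metis inj_onI phi_psi)

lemma psi_hol: "\<psi> holomorphic_on \<Omega>"
  and deriv_psi: "norm w < 1 \<Longrightarrow> deriv \<phi> w * deriv \<psi> (\<phi> w) = 1"
proof -
  obtain g where g: "g holomorphic_on \<phi> ` ball 0 1"
      "\<And>z. z \<in> ball 0 1 \<Longrightarrow> deriv \<phi> z * deriv g (\<phi> z) = 1" "\<And>z. z \<in> ball 0 1 \<Longrightarrow> g (\<phi> z) = z"
    using holomorphic_has_inverse[OF hol open_ball inj] by metis
  have eq: "g z = \<psi> z" if "z \<in> \<Omega>" for z
    using g(3)[of "\<psi> z"] psi_in[OF that] phi_psi[OF that] by simp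
  then show "\<psi> holomorphic_on \<Omega>"
    using g(1) unfolding image by (metis holomorphic_cong)
  show "deriv \<phi> w * deriv \<psi> (\<phi> w) = 1" if "norm w < 1"
  proof -
    \<comment> \<open>\<open>g\<close> agrees with \<open>\<psi>\<close> only on
      \<open>\<Omega>\<close>; openness of \<open>\<Omega>\<close> lets the derivatives be
      identified.\<close>
    have "\<forall>\<^sub>F z in nhds (\<phi> w). \<psi> z = g z"
      using eventually_nhds_in_open[OF open_dom phi_in[OF that]] eq by (auto elim!: eventually_mono)
    then have "deriv \<psi> (\<phi> w) = deriv g (\<phi> w)" by (intro deriv_cong_ev) auto
    then show ?thesis using g(2) that by simp
  qed
qed

lemma deriv_phi_nz: "norm w < 1 \<Longrightarrow> deriv \<phi> w \<noteq> 0"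
  using deriv_psi by force

lemma norm_deriv_psi: "norm w < 1 \<Longrightarrow> norm (deriv \<psi> (\<phi> w)) = 1 / norm (deriv \<phi> w)"
  using deriv_psi[of w] deriv_phi_nz[of w] by (metis nonzero_mult_div_cancel_left norm_divide norm_one)

lemma delta_pos: "z \<in> \<Omega> \<Longrightarrow> 0 < \<delta> z"
  by (rule bdist_pos[OF open_dom bounded_dom])

lemma deriv_phi_upper:
  assumes "norm w < 1"
  shows "(1 - norm w) * norm (deriv \<phi> w) \<le> 12 * pi * \<delta> (\<phi> w)"
proof (rule koebe_deriv_le_bdist[OF _ _ _ _ open_dom bounded_dom])
  have sub: "ball w (1 - norm w) \<subseteq> ball 0 1"
    by (simp add: ball_subset_ball_iff)
  show "\<phi> holomorphic_on ball w (1 - norm w)" using hol sub by (rule holomorphic_on_subset)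
  show "inj_on \<phi> (ball w (1 - norm w))" using inj sub by (rule inj_on_subset)
  show "\<phi> ` ball w (1 - norm w) \<subseteq> \<Omega>" using image sub by blast
qed (use assms in auto)

text \<open>The Koebe bound for \<open>\<psi>\<close> on the ball of radius
  \<open>\<delta> (\<phi> w)\<close>, rewritten with |\<psi>'| = 1 / |\<phi>'|. Together with
  \<open>deriv_phi_upper\<close> it shows that |\<phi>'(w)| (1 - |w|) is comparable to the distance
  to the boundary.\<close>

lemma deriv_phi_lower:
  assumes w: "norm w < 1"
  shows "\<delta> (\<phi> w) \<le> 12 * pi * ((1 - norm w) * norm (deriv \<phi> w))"
proof -
  note sub = ball_bdist_subset[OF phi_in[OF w]]
  have "\<delta> (\<phi> w) * norm (deriv \<psi> (\<phi> w)) \<le> 12 * pi * bdist (ball 0 1) (\<psi> (\<phi> w))"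
  proof (rule koebe_deriv_le_bdist)
    show "\<psi> holomorphic_on ball (\<phi> w) (\<delta> (\<phi> w))" using psi_hol sub by (rule holomorphic_on_subset)
    show "inj_on \<psi> (ball (\<phi> w) (\<delta> (\<phi> w)))" using inj_psi sub by (rule inj_on_subset)
    show "\<psi> ` ball (\<phi> w) (\<delta> (\<phi> w)) \<subseteq> ball 0 1" using sub psi_in by auto
  qed (use delta_pos phi_in w in auto)
  also have "\<dots> \<le> 12 * pi * (1 - norm w)"
    using bdist_unit_ball_le[of w] w psi_phi[OF w] by simp
  finally show ?thesis
    using norm_deriv_psi[OF w] deriv_phi_nz[OF w] by (simp add: field_simps)
qed

text \<open>The covering theorem for \<open>\<psi>\<close> on the half-radius ball gives a disc of
  radius \<delta> |\<psi>'| / (24 pi) around \<open>w\<close>. By \<open>deriv_phi_upper\<close>,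
  \<delta> |\<psi>'| is at least (1 - |w|) / (12 pi), whence the constant 288 = 24 * 12. The target
  is a Whitney ball.\<close>

lemma phi_image_small_ball:
  assumes w: "norm w < 1"
  shows "\<phi> ` ball w ((1 - norm w) / (288 * pi\<^sup>2)) \<subseteq> ball (\<phi> w) (\<delta> (\<phi> w) / 2)"
proof -
  let ?d = "\<delta> (\<phi> w)"
  have d: "0 < ?d" using delta_pos phi_in w by simp
  have sub: "ball (\<phi> w) (?d / 2) \<subseteq> \<Omega>"
    using ball_bdist_subset[OF phi_in[OF w]] d by (rule_tac order_trans[OF subset_ball]) auto
  have "ball (\<psi> (\<phi> w)) (?d / 2 * norm (deriv \<psi> (\<phi> w)) / (12 * pi)) \<subseteq> \<psi> ` ball (\<phi> w) (?d / 2)"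
    by (rule koebe_ball_subset_image) (use d sub psi_hol inj_psi holomorphic_on_subset inj_on_subset in auto)
  moreover have "(1 - norm w) / (288 * pi\<^sup>2) \<le> ?d / 2 * norm (deriv \<psi> (\<phi> w)) / (12 * pi)"
  proof -
    have "1 - norm w = (1 - norm w) * norm (deriv \<phi> w) * norm (deriv \<psi> (\<phi> w))"
      using deriv_phi_nz[OF w] norm_deriv_psi[OF w] by simp
    also have "\<dots> \<le> 12 * pi * ?d * norm (deriv \<psi> (\<phi> w))"
      by (intro mult_right_mono deriv_phi_upper w) auto
    finally have "(1 - norm w) / (288 * pi\<^sup>2) \<le> 12 * pi * ?d * norm (deriv \<psi> (\<phi> w)) / (288 * pi\<^sup>2)"
      by (intro divide_right_mono) auto
    also have "\<dots> = ?d / 2 * norm (deriv \<psi> (\<phi> w)) / (12 * pi)"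
      by (simp add: power2_eq_square)
    finally show ?thesis .
  qed
  ultimately have "ball w ((1 - norm w) / (288 * pi\<^sup>2)) \<subseteq> \<psi> ` ball (\<phi> w) (?d / 2)"
    using psi_phi[OF w] by (metis subset_ball subset_trans)
  then have "\<phi> ` ball w ((1 - norm w) / (288 * pi\<^sup>2)) \<subseteq> (\<lambda>z. \<phi> (\<psi> z)) ` ball (\<phi> w) (?d / 2)"
    using image_mono[of _ _ \<phi>] by (simp add: image_image[symmetric])
  also have "\<dots> = id ` ball (\<phi> w) (?d / 2)"
    by (rule image_cong) (use sub phi_psi in auto)
  finally show ?thesis by simp
qed

text \<open>With a = \<open>\<psi> z\<close> and b = \<open>\<psi> x\<close>, Schwarz-Pick gives |a
  - b| \<le> |1 - cnj a b| / 2. Writing 1 - cnj a b as (1 - |a|^2) + cnj a (a - b) bounds |1 - cnj a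
  b| by 2 (1 - |a|) plus half of itself, and the half is absorbed. These bounds let the test kernel
  at a be estimated on a whole Whitney ball.\<close>

lemma psi_half_ball:
  assumes z: "z \<in> \<Omega>" and x: "x \<in> ball z (\<delta> z / 2)"
  shows "norm (1 - cnj (\<psi> z) * \<psi> x) \<le> 4 * (1 - norm (\<psi> z))"
    and "1 - norm (\<psi> z) \<le> 4 * (1 - norm (\<psi> x))"
proof -
  let ?a = "\<psi> z" and ?b = "\<psi> x"
  have d: "0 < \<delta> z" using delta_pos z by simp
  have xO: "x \<in> \<Omega>" using ball_bdist_subset[OF z] x d by auto
  have SP: "norm (?b - ?a) \<le> norm (1 - cnj ?a * ?b) / 2"
  proof (rule Schwarz_Pick_half_ball[OF _ d _ x])
    show "\<psi> holomorphic_on ball z (\<delta> z)" using psi_hol ball_bdist_subset[OF z] by (rule holomorphic_on_subset)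
  qed (use ball_bdist_subset[OF z] psi_in in auto)
  have a: "norm ?a < 1" and b: "norm ?b < 1" using psi_in z xO by auto
  have sq: "norm (1 - cnj c * c) \<le> 2 * (1 - norm c)" if "norm c < 1" for c :: complex
  proof -
    have "1 - cnj c * c = of_real (1 - (norm c)\<^sup>2)"
      by (simp add: complex_norm_square mult.commute flip: of_real_power)
    then have "norm (1 - cnj c * c) = \<bar>1 - (norm c)\<^sup>2\<bar>" by (metis norm_of_real)
    also have "\<dots> = (1 + norm c) * (1 - norm c)"
      using that by (simp add: power2_eq_square algebra_simps mult_le_one)
    also have "\<dots> \<le> 2 * (1 - norm c)" using that by (intro mult_right_mono) auto
    finally show ?thesis .
  qed
  have "1 - cnj ?a * ?b = (1 - cnj ?a * ?a) + cnj ?a * (?a - ?b)" by (simp add: algebra_simps)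
  then have "norm (1 - cnj ?a * ?b) \<le> norm (1 - cnj ?a * ?a) + norm ?a * norm (?a - ?b)"
    by (metis norm_triangle_ineq norm_mult complex_mod_cnj)
  also have "norm ?a * norm (?a - ?b) \<le> 1 * norm (?a - ?b)"
    using a by (intro mult_right_mono) auto
  finally show "norm (1 - cnj ?a * ?b) \<le> 4 * (1 - norm ?a)"
    using sq[OF a] SP by (simp add: norm_minus_commute)
  \<comment> \<open>Conjugation exchanges the roles of the two points, so the same absorption works
    with 1 - |b|.\<close>
  have "cnj (1 - cnj ?a * ?b) = (1 - cnj ?b * ?b) + cnj ?b * (?b - ?a)" by (simp add: algebra_simps)
  then have "norm (1 - cnj ?a * ?b) \<le> norm (1 - cnj ?b * ?b) + norm ?b * norm (?b - ?a)"
    by (metis norm_triangle_ineq norm_mult complex_mod_cnj)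
  also have "norm ?b * norm (?b - ?a) \<le> 1 * norm (?b - ?a)"
    using b by (intro mult_right_mono) auto
  finally have "norm (1 - cnj ?a * ?b) \<le> 4 * (1 - norm ?b)"
    using sq[OF b] SP by simp
  moreover have "1 - norm ?a \<le> norm (1 - cnj ?a * ?b)"
  proof -
    have "norm (cnj ?a * ?b) \<le> norm ?a" using b by (simp add: norm_mult mult_left_le)
    then show ?thesis using norm_triangle_ineq2[of 1 "cnj ?a * ?b"] by simp
  qed
  ultimately show "1 - norm ?a \<le> 4 * (1 - norm ?b)" by linarith
qed

end

section \<open>Poisson integrals and subharmonicity\<close>

text \<open>The Poisson kernel of the disc of radius \<open>\<rho>\<close> about 0, with the factor
  1 / (2 pi) built in so that it has total mass 1 for dt on \<open>{0..2*pi}\<close>.\<close>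

definition poisson_kernel :: "real \<Rightarrow> complex \<Rightarrow> real \<Rightarrow> real" where
  "poisson_kernel \<rho> w t = (\<rho>\<^sup>2 - (norm w)\<^sup>2) / (2 * pi * (norm (\<rho> * cis t - w))\<^sup>2)"

lemma poisson_kernel_nonneg: "norm w < \<rho> \<Longrightarrow> 0 \<le> poisson_kernel \<rho> w t"
  by (auto simp: poisson_kernel_def intro!: divide_nonneg_nonneg power_mono)

lemma circle_point_neq: "norm w < \<rho> \<Longrightarrow> of_real \<rho> * cis t \<noteq> w"
  by (metis abs_of_nonneg less_imp_le less_irrefl mult.right_neutral norm_cis norm_ge_zero norm_mult norm_of_real order.trans)

lemma continuous_on_poisson_kernel:
  assumes "norm w < \<rho>"
  shows "continuous_on A (poisson_kernel \<rho> w)"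
  unfolding poisson_kernel_def
  by (intro continuous_intros) (use circle_point_neq[OF assms] in auto)

text \<open>For nonzero \<open>a\<close> the only zero is the mirror image of \<open>a\<close> in
  the circle of radius \<open>\<rho>\<close>, which lies outside the closed disc.\<close>

lemma reflected_nonzero:
  assumes "norm a < \<rho>" "norm z \<le> \<rho>"
  shows "of_real (\<rho>\<^sup>2) - cnj a * z \<noteq> 0"
proof
  assume "of_real (\<rho>\<^sup>2) - cnj a * z = 0"
  then have "norm (of_real (\<rho>\<^sup>2) :: complex) = norm (cnj a * z)" by simp
  then have "\<rho>\<^sup>2 = norm a * norm z" by (simp add: norm_mult norm_power)
  also have "\<dots> \<le> norm a * \<rho>" using assms by (intro mult_left_mono) auto
  also have "\<dots> < \<rho> * \<rho>" using assms norm_ge_zero[of a] by (intro mult_strict_right_mono) linarith+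
  finally show False by (simp add: power2_eq_square)
qed

text \<open>Cauchy's formula for \<open>F\<close> times (\<rho>^2 - |w|^2) / (\<rho>^2 - cnj w z).
  The extra factor is 1 at z = w, and on the circle it turns the Cauchy kernel into the Poisson
  kernel.\<close>

lemma poisson_formula:
  assumes cont: "continuous_on (cball 0 \<rho>) F" and hol: "F holomorphic_on ball 0 \<rho>" and w: "norm w < \<rho>"
  shows "((\<lambda>t. of_real (poisson_kernel \<rho> w t) * F (\<rho> * cis t)) has_integral F w) {0..2*pi}"
proof -
  have \<rho>: "0 < \<rho>" using w norm_ge_zero[of w] by linarith
  define G where "G = (\<lambda>z. F z * of_real (\<rho>\<^sup>2 - (norm w)\<^sup>2) / (of_real (\<rho>\<^sup>2) - cnj w * z))"
  note nz = reflected_nonzero[OF w]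
  have "((\<lambda>u. G u / (u - w)) has_contour_integral (2 * of_real pi * \<i> * G w)) (circlepath 0 \<rho>)"
  proof (rule Cauchy_integral_circlepath)
    show "continuous_on (cball 0 \<rho>) G"
      unfolding G_def by (intro continuous_intros cont) (use nz in auto)
    show "G holomorphic_on ball 0 \<rho>"
      unfolding G_def by (intro holomorphic_intros hol) (use nz in \<open>force dest: less_imp_le\<close>)
  qed (use w in auto)
  moreover have "G w = F w"
  proof -
    have "(of_real (\<rho>\<^sup>2) - cnj w * w :: complex) = of_real (\<rho>\<^sup>2 - (norm w)\<^sup>2)"
      by (simp add: complex_norm_square mult.commute flip: of_real_power)
    moreover have "of_real (\<rho>\<^sup>2) - cnj w * w \<noteq> 0" using nz[of w] w by simp
    ultimately show ?thesis by (simp add: G_def)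
  qed
  ultimately have "((\<lambda>t. G (0 + \<rho> * cis t) / (0 + \<rho> * cis t - w) * \<rho> * \<i> * cis t) has_integral
      (2 * of_real pi * \<i> * F w)) {0..2*pi}"
    unfolding circlepath_def by (subst (asm) has_contour_integral_part_circlepath_iff) auto
  then have "((\<lambda>t. G (0 + \<rho> * cis t) / (0 + \<rho> * cis t - w) * \<rho> * \<i> * cis t * (1 / (2 * of_real pi * \<i>))) has_integral
      (2 * of_real pi * \<i> * F w) * (1 / (2 * of_real pi * \<i>))) {0..2*pi}"
    by (rule has_integral_mult_left)
  moreover have "G (0 + \<rho> * cis t) / (0 + \<rho> * cis t - w) * \<rho> * \<i> * cis t * (1 / (2 * of_real pi * \<i>)) =
      of_real (poisson_kernel \<rho> w t) * F (\<rho> * cis t)" for t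
  proof -
    define u where "u = of_real \<rho> * cis t"
    have uu: "of_real (\<rho>\<^sup>2) = u * cnj u"
      using complex_norm_square[of u] \<rho> by (simp add: u_def norm_mult)
    have u0: "u \<noteq> 0" and uw: "u - w \<noteq> 0" using \<rho> circle_point_neq[OF w] by (auto simp: u_def)
    have cuw: "cnj u - cnj w \<noteq> 0" using uw by (metis complex_cnj_diff complex_cnj_zero_iff)
    have nn: "of_real ((norm (u - w))\<^sup>2) = (u - w) * (cnj u - cnj w)"
      using complex_norm_square[of "u - w"] by simp
    \<comment> \<open>On the circle \<rho>^2 = u cnj u, so the denominator of \<open>G\<close> is u
      cnj (u - w); together with the Cauchy factor u - w it produces |u - w|^2.\<close>
    have den: "of_real (\<rho>\<^sup>2) - cnj w * u = u * (cnj u - cnj w)"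
      unfolding uu by (simp add: algebra_simps)
    have pk: "of_real (poisson_kernel \<rho> w t) = of_real (\<rho>\<^sup>2 - (norm w)\<^sup>2) / (2 * of_real pi * ((u - w) * (cnj u - cnj w)))"
      unfolding poisson_kernel_def u_def[symmetric] nn[symmetric] by simp
    have alg: "X * c / (r * e * D) / E * r * \<i> * e * (1 / (2 * P * \<i>)) = c / (2 * P * (E * D)) * X"
      if "r \<noteq> 0" "e \<noteq> 0" "D \<noteq> 0" "E \<noteq> 0" "P \<noteq> 0" for X c r e D E P :: complex
      using that by (simp add: field_simps)
    show ?thesis
      unfolding pk G_def add_0_left u_def[symmetric] den
      using alg[of \<rho> "cis t" "cnj u - cnj w" "u - w" "of_real pi" "F u" "of_real (\<rho>\<^sup>2 - (norm w)\<^sup>2)"]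
        \<rho> uw cuw unfolding u_def[symmetric] by simp
  qed
  moreover have "(2 * of_real pi * \<i> * F w) * (1 / (2 * of_real pi * \<i>)) = F w" by simp
  ultimately show ?thesis by (simp only:)
qed

lemma poisson_kernel_integral:
  assumes w: "norm w < \<rho>"
  shows "(poisson_kernel \<rho> w has_integral 1) {0..2*pi}"
proof -
  have "((\<lambda>t. of_real (poisson_kernel \<rho> w t) * (1::complex)) has_integral 1) {0..2*pi}"
    by (rule poisson_formula[OF _ _ w]) auto
  then have "((\<lambda>t. Re (of_real (poisson_kernel \<rho> w t) * (1::complex))) has_integral Re 1) {0..2*pi}"
    by (rule has_integral_Re)
  then show ?thesis by simp
qed

lemma norm_le_poisson_integral:
  assumes cont: "continuous_on (cball 0 \<rho>) F" and hol: "F holomorphic_on ball 0 \<rho>" and w: "norm w < \<rho>"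
  shows "norm (F w) \<le> integral {0..2*pi} (\<lambda>t. poisson_kernel \<rho> w t * norm (F (\<rho> * cis t)))"
proof -
  have \<rho>: "0 < \<rho>" using w norm_ge_zero[of w] by linarith
  note P = poisson_formula[OF assms]
  have contF: "continuous_on {0..2*pi} (\<lambda>t. F (\<rho> * cis t))"
    by (rule continuous_on_compose2[OF cont]) (use \<rho> in \<open>auto intro!: continuous_intros simp: norm_mult\<close>)
  have "norm (F w) = norm (integral {0..2*pi} (\<lambda>t. of_real (poisson_kernel \<rho> w t) * F (\<rho> * cis t)))"
    using P by (simp add: integral_unique)
  also have "\<dots> \<le> integral {0..2*pi} (\<lambda>t. poisson_kernel \<rho> w t * norm (F (\<rho> * cis t)))"
  proof (rule integral_norm_bound_integral)
    show "(\<lambda>t. of_real (poisson_kernel \<rho> w t) * F (\<rho> * cis t)) integrable_on {0..2*pi}"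
      using P by blast
    show "(\<lambda>t. poisson_kernel \<rho> w t * norm (F (\<rho> * cis t))) integrable_on {0..2*pi}"
      by (intro integrable_continuous_real continuous_intros contF continuous_on_poisson_kernel w)
  qed (use poisson_kernel_nonneg[OF w] in \<open>simp add: norm_mult\<close>)
  finally show ?thesis .
qed

section \<open>Blaschke factors and subharmonicity of powers\<close>

lemma norm_diff_le_reflected:
  assumes "norm a < \<rho>"
  shows "norm z \<le> \<rho> \<Longrightarrow> \<rho> * norm (z - a) \<le> norm (of_real (\<rho>\<^sup>2) - cnj a * z)"
    and "norm z = \<rho> \<Longrightarrow> \<rho> * norm (z - a) = norm (of_real (\<rho>\<^sup>2) - cnj a * z)"
proof -
  have \<rho>: "0 < \<rho>" using assms norm_ge_zero[of a] by linarith
  \<comment> \<open>The identity behind the modulus of a Blaschke factor: the right-hand side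
    vanishes on the circle and is nonnegative inside.\<close>
  have id: "(norm (of_real (\<rho>\<^sup>2) - cnj a * z))\<^sup>2 - (\<rho> * norm (z - a))\<^sup>2 = (\<rho>\<^sup>2 - (norm z)\<^sup>2) * (\<rho>\<^sup>2 - (norm a)\<^sup>2)"
    unfolding power_mult_distrib cmod_power2 by (simp add: algebra_simps power2_eq_square)
  show "\<rho> * norm (z - a) = norm (of_real (\<rho>\<^sup>2) - cnj a * z)" if "norm z = \<rho>"
    using id that \<rho> by (simp add: power2_eq_iff_nonneg)
  show "\<rho> * norm (z - a) \<le> norm (of_real (\<rho>\<^sup>2) - cnj a * z)" if "norm z \<le> \<rho>"
  proof (rule power2_le_imp_le)
    have "0 \<le> (\<rho>\<^sup>2 - (norm z)\<^sup>2) * (\<rho>\<^sup>2 - (norm a)\<^sup>2)"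
      using that assms by (intro mult_nonneg_nonneg) (auto intro!: power_mono)
    then show "(\<rho> * norm (z - a))\<^sup>2 \<le> (norm (of_real (\<rho>\<^sup>2) - cnj a * z))\<^sup>2" using id by linarith
  qed auto
qed

text \<open>The local factorisation near \<open>a\<close> and the quotient by (z - a)^n away from
  \<open>a\<close> agree where both are defined, so they glue to a holomorphic function on all of
  \<open>S\<close>.\<close>

lemma factor_zero_power:
  assumes hol: "f holomorphic_on S" and S: "open S" "connected S" and a: "a \<in> S"
    and nz: "\<exists>z\<in>S. f z \<noteq> 0"
  obtains h n where "h holomorphic_on S" "\<And>z. z \<in> S \<Longrightarrow> f z = (z - a) ^ n * h z" "h a \<noteq> 0"
proof (cases "f a = 0 \<and> \<not> f constant_on S")
  case True
  then obtain g r n where g: "0 < n" "0 < r" "ball a r \<subseteq> S" "g holomorphic_on ball a r"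
      "\<And>w. w \<in> ball a r \<Longrightarrow> f w = (w - a) ^ n * g w" "\<And>w. w \<in> ball a r \<Longrightarrow> g w \<noteq> 0"
    using holomorphic_factor_zero_nonconstant[OF hol S a] by metis
  define h where "h = (\<lambda>z. if z \<in> ball a r then g z else f z / (z - a) ^ n)"
  have h1: "h holomorphic_on ball a r"
    using g(4) by (rule holomorphic_transform) (simp add: h_def)
  have "(\<lambda>z. f z / (z - a) ^ n) holomorphic_on S - {a}"
    by (intro holomorphic_intros holomorphic_on_subset[OF hol]) auto
  then have h2: "h holomorphic_on S - {a}"
    by (rule holomorphic_transform) (use g(5) in \<open>auto simp: h_def\<close>)
  have "h holomorphic_on ball a r \<union> (S - {a})"
    by (rule holomorphic_on_Un[OF h1 h2]) (use S in auto)
  moreover have "ball a r \<union> (S - {a}) = S" using g(2,3) a by auto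
  ultimately have "h holomorphic_on S" by simp
  moreover have "f z = (z - a) ^ n * h z" if "z \<in> S" for z
    using g(2,5) that by (cases "z = a") (auto simp: h_def)
  moreover have "h a \<noteq> 0" using g(2,6) by (auto simp: h_def)
  ultimately show ?thesis using that by blast
next
  case False
  \<comment> \<open>If \<open>f\<close> is constant, it is a nonzero constant by \<open>nz\<close>;
    so exponent 0 serves in this case.\<close>
  then have "f a \<noteq> 0"
    using nz a by (auto simp: constant_on_def)
  then show ?thesis using that[of f 0] hol by simp
qed

text \<open>Induction on the set of zeros in the closed disc: each step divides by a power of one
  Blaschke factor, which keeps the modulus on the circle and does not decrease it inside.\<close>

lemma remove_zeros_in_disc:
  assumes "finite Z" "Z = {z \<in> cball 0 \<rho>. g z = 0}" "g holomorphic_on ball 0 1" "\<rho> < 1"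
    "\<And>z. norm z = \<rho> \<Longrightarrow> g z \<noteq> 0" "0 < \<rho>"
  shows "\<exists>h. h holomorphic_on ball 0 1 \<and> (\<forall>z\<in>cball 0 \<rho>. h z \<noteq> 0 \<and> norm (g z) \<le> norm (h z)) \<and>
      (\<forall>z. norm z = \<rho> \<longrightarrow> norm (h z) = norm (g z))"
  using assms
proof (induction Z arbitrary: g rule: finite_induct)
  case empty
  then show ?case by (intro exI[of _ g]) auto
next
  case (insert a Z)
  have a: "g a = 0" "norm a < \<rho>"
    using insert.prems(1,4) by (auto simp: le_less)
  \<comment> \<open>The point \<rho> lies on the zero-free circle and shows that \<open>g\<close>
    does not vanish identically.\<close>
  have "g (of_real \<rho>) \<noteq> 0" using insert.prems(4)[of "of_real \<rho>"] insert.prems(5) by simp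
  then have ex: "\<exists>z\<in>ball 0 1. g z \<noteq> 0"
    using insert.prems(3,5) by (intro bexI[of _ "of_real \<rho>"]) auto
  have aB: "a \<in> ball 0 1" using a insert.prems(3) by simp
  obtain h n where h: "h holomorphic_on ball 0 1" "\<And>z. z \<in> ball 0 1 \<Longrightarrow> g z = (z - a) ^ n * h z" "h a \<noteq> 0"
    using factor_zero_power[OF insert.prems(2) open_ball connected_ball aB ex] by metis
  \<comment> \<open>\<open>g\<close> divided by the n-th power of \<rho> (z - a) / (\<rho>^2 - cnj a
    z), written so that it is visibly holomorphic at \<open>a\<close>.\<close>
  define k where "k = (\<lambda>z. ((of_real (\<rho>\<^sup>2) - cnj a * z) / of_real \<rho>) ^ n * h z)"
  have n0: "n \<noteq> 0" using h(2)[OF aB] h(3) a(1) by (cases n) auto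
  have \<rho>: "0 < \<rho>" by fact
  note nz = reflected_nonzero[OF a(2)]
  have "Z = {z \<in> cball 0 \<rho>. k z = 0}"
  proof -
    have "k z = 0 \<longleftrightarrow> z \<in> Z" if "z \<in> cball 0 \<rho>" for z
    proof -
      have z: "norm z \<le> \<rho>" "z \<in> ball 0 1" using that insert.prems(3) by auto
      have "k z = 0 \<longleftrightarrow> h z = 0" using nz[OF z(1)] n0 \<rho> by (simp add: k_def)
      also have "\<dots> \<longleftrightarrow> g z = 0 \<and> z \<noteq> a" using h(2)[OF z(2)] h(3) n0 by auto
      also have "\<dots> \<longleftrightarrow> z \<in> Z" using insert.prems(1) insert.hyps(2) that by auto
      finally show ?thesis .
    qed
    moreover have "Z \<subseteq> cball 0 \<rho>" using insert.prems(1) by auto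
    ultimately show ?thesis by auto
  qed
  moreover have "k holomorphic_on ball 0 1"
    unfolding k_def by (intro holomorphic_intros h) (use \<rho> in auto)
  moreover have eq: "norm (k z) = norm (g z)" if "norm z = \<rho>" for z
  proof -
    have "norm (z - a) = norm (of_real (\<rho>\<^sup>2) - cnj a * z) / \<rho>"
      using norm_diff_le_reflected(2)[OF a(2) that] \<rho> by (simp add: field_simps)
    then show ?thesis
      using h(2)[of z] that insert.prems(3) \<rho> by (simp add: k_def norm_mult norm_power norm_divide)
  qed
  moreover have le: "norm (g z) \<le> norm (k z)" if "norm z \<le> \<rho>" for z
  proof -
    have "norm (z - a) \<le> norm (of_real (\<rho>\<^sup>2) - cnj a * z) / \<rho>"
      using norm_diff_le_reflected(1)[OF a(2) that] \<rho> by (simp add: field_simps)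
    then show ?thesis
      using h(2)[of z] that insert.prems(3) \<rho>
      by (auto simp: k_def norm_mult norm_power norm_divide intro!: mult_right_mono power_mono)
  qed
  moreover have "k z \<noteq> 0" if "norm z = \<rho>" for z
    using eq[OF that] insert.prems(4)[OF that] by auto
  ultimately obtain H where H: "H holomorphic_on ball 0 1" "\<forall>z\<in>cball 0 \<rho>. H z \<noteq> 0 \<and> norm (k z) \<le> norm (H z)"
      "\<forall>z. norm z = \<rho> \<longrightarrow> norm (H z) = norm (k z)"
    using insert.IH[of k] insert.prems(3,5) by blast
  have "norm (g z) \<le> norm (H z)" if "norm z \<le> \<rho>" for z
    using le[OF that] H(2) that by (meson mem_cball_0 order_trans)
  then show ?case
    using H eq by (intro exI[of _ H]) auto
qed

text \<open>A power of a zero-free \<open>h\<close> is the modulus of exp (a log h), to which the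
  estimate for holomorphic functions applies. Removing the zeros of \<open>g\<close> only raises the
  left-hand side and leaves the boundary values alone, so every exponent \<open>a\<close> > 0 is
  allowed.\<close>

lemma powr_norm_le_poisson_integral:
  assumes hol: "g holomorphic_on ball 0 1" and \<rho>: "\<rho> < 1" and nz: "\<And>z. norm z = \<rho> \<Longrightarrow> g z \<noteq> 0"
    and w: "norm w < \<rho>" and a: "0 < a"
  shows "norm (g w) powr a \<le> integral {0..2*pi} (\<lambda>t. poisson_kernel \<rho> w t * norm (g (\<rho> * cis t)) powr a)"
proof -
  have \<rho>0: "0 < \<rho>" using w norm_ge_zero[of w] by linarith
  have "\<not> g constant_on ball 0 1 \<or> (\<forall>z\<in>ball 0 1. g z \<noteq> 0)"
    using nz[of "of_real \<rho>"] \<rho> \<rho>0 by (force simp: constant_on_def)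
  then have "finite {z \<in> cball 0 \<rho>. g z = 0}"
  proof
    assume "\<not> g constant_on ball 0 1"
    then show ?thesis
      by (intro holomorphic_compact_finite_zeros[OF hol]) (use \<rho> in auto)
  next
    assume "\<forall>z\<in>ball 0 1. g z \<noteq> 0"
    then have "{z \<in> cball 0 \<rho>. g z = 0} = {}" using \<rho> by force
    then show ?thesis by (metis finite.emptyI)
  qed
  from remove_zeros_in_disc[OF this refl hol \<rho> nz \<rho>0] obtain h where h: "h holomorphic_on ball 0 1"
    "\<And>z. norm z \<le> \<rho> \<Longrightarrow> h z \<noteq> 0" "\<And>z. norm z \<le> \<rho> \<Longrightarrow> norm (g z) \<le> norm (h z)"
      "\<And>z. norm z = \<rho> \<Longrightarrow> norm (h z) = norm (g z)" by auto
  \<comment> \<open>The logarithm needs an open disc larger than the closed one so that it is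
    continuous up to the circle; compactness supplies the margin \<open>e\<close>.\<close>
  have "open {z \<in> ball 0 1. h z \<noteq> 0}"
    using continuous_open_preimage[OF holomorphic_on_imp_continuous_on[OF h(1)] open_ball, of "- {0}"]
    by (simp add: vimage_def Int_def open_Compl)
  then obtain e where e: "e > 0" "(\<Union>x\<in>cball 0 \<rho>. ball x e) \<subseteq> {z \<in> ball 0 1. h z \<noteq> 0}"
    by (rule compact_subset_open_imp_ball_epsilon_subset[OF compact_cball[of 0 \<rho>]]) (use h(2) \<rho> in auto)
  have sub: "z \<in> ball 0 1 \<and> h z \<noteq> 0" if z: "norm z < \<rho> + e" for z
  proof -
    have "\<exists>x\<in>cball 0 \<rho>. z \<in> ball x e"
    proof (cases "norm z \<le> \<rho>")
      case True
      then show ?thesis using e(1) by (intro bexI[of _ z]) auto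
    next
      case False
      \<comment> \<open>The radial projection of \<open>z\<close> to the circle is closer to
        \<open>z\<close> than \<open>e\<close>.\<close>
      define x where "x = of_real (\<rho> / norm z) * z"
      have z0: "z \<noteq> 0" using False \<rho>0 by auto
      have "z - x = of_real (1 - \<rho> / norm z) * z" by (simp add: x_def algebra_simps)
      then have "norm (z - x) = \<bar>1 - \<rho> / norm z\<bar> * norm z" by (simp only: norm_mult norm_of_real)
      also have "\<bar>1 - \<rho> / norm z\<bar> = 1 - \<rho> / norm z" using False \<rho>0 by (auto intro!: abs_of_nonneg simp: divide_le_eq)
      also have "(1 - \<rho> / norm z) * norm z = norm z - \<rho>" using z0 by (simp add: field_simps)
      finally have "norm (z - x) < e" using z by simp
      moreover have "norm x = \<rho>" using False \<rho>0 by (auto simp: x_def norm_mult norm_divide)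
      ultimately show ?thesis by (intro bexI[of _ x]) (auto simp: dist_norm norm_minus_commute)
    qed
    then show ?thesis using e(2) by blast
  qed
  have "h holomorphic_on ball 0 (\<rho> + e)"
    by (rule holomorphic_on_subset[OF h(1)]) (use sub in auto)
  then obtain L where L: "L holomorphic_on ball 0 (\<rho> + e)" "\<And>z. norm z < \<rho> + e \<Longrightarrow> exp (L z) = h z"
    using holomorphic_logarithm_exists[of "ball 0 (\<rho> + e)" h 0] sub \<rho>0 e(1) by auto
  define F where "F = (\<lambda>z. exp (of_real a * L z))"
  have F: "F holomorphic_on ball 0 (\<rho> + e)"
    unfolding F_def by (intro holomorphic_intros L)
  have normF: "norm (F z) = norm (h z) powr a" if "norm z \<le> \<rho>" for z
  proof -
    have "norm (h z) = exp (Re (L z))" using L(2)[of z] that e(1) by (metis norm_exp_eq_Re le_add_same_cancel1 less_add_same_cancel1 order_le_less_trans)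
    then show ?thesis by (simp add: F_def powr_def norm_exp_eq_Re)
  qed
  have "norm (g w) powr a \<le> norm (h w) powr a"
    using h(3)[of w] w a by (intro powr_mono2) auto
  also have "\<dots> = norm (F w)" using normF[of w] w by simp
  also have "\<dots> \<le> integral {0..2*pi} (\<lambda>t. poisson_kernel \<rho> w t * norm (F (\<rho> * cis t)))"
  proof (rule norm_le_poisson_integral[OF _ _ w])
    show "continuous_on (cball 0 \<rho>) F" "F holomorphic_on ball 0 \<rho>"
      using F e(1) by (auto intro!: holomorphic_on_imp_continuous_on elim!: holomorphic_on_subset)
  qed
  also have "\<dots> = integral {0..2*pi} (\<lambda>t. poisson_kernel \<rho> w t * norm (g (\<rho> * cis t)) powr a)"
    using normF h(4) \<rho>0 by (intro integral_cong) (simp add: norm_mult)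
  finally show ?thesis .
qed

section \<open>Geometric sums and chords\<close>

lemma sum_geometric_subset_le:
  fixes r :: real
  assumes "0 < r" "r < 1" "finite J"
  shows "(\<Sum>k\<in>J. r ^ k) \<le> 1 / (1 - r)"
  using sum_le_suminf[of "\<lambda>k. r ^ k" J] assms by (simp add: suminf_geometric summable_geometric)

text \<open>A decreasing geometric sum is dominated by its term of least index, whatever the number
  of terms.\<close>

lemma sum_power_le_of_bound:
  fixes r :: real
  assumes r: "0 < r" "r < 1" and I: "finite I" and B: "0 \<le> B" "\<And>n. n \<in> I \<Longrightarrow> r ^ n \<le> B"
  shows "(\<Sum>n\<in>I. r ^ n) \<le> B / (1 - r)"
proof (cases "I = {}")
  case True
  then show ?thesis using r B by simp
next
  case False
  define m where "m = Min I"
  have m: "m \<in> I" "\<And>n. n \<in> I \<Longrightarrow> m \<le> n" using I False by (auto simp: m_def)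
  have 1: "x = y" if "x - m = y - m" "x \<in> I" "y \<in> I" for x y using that m(2) by (metis eq_diff_iff)
  have "(\<Sum>n\<in>I. r ^ n) = (\<Sum>n\<in>I. r ^ m * r ^ (n - m))"
    using m by (intro sum.cong) (simp_all flip: power_add)
  also have "\<dots> = r ^ m * (\<Sum>k\<in>(\<lambda>n. n - m) ` I. r ^ k)"
    unfolding sum_distrib_left by (subst sum.reindex) (auto intro!: inj_onI dest: 1)
  also have "\<dots> \<le> B * (1 / (1 - r))"
    using r B(1) B(2)[OF m(1)] I by (intro mult_mono sum_geometric_subset_le) (auto intro!: sum_nonneg)
  finally show ?thesis by simp
qed

text \<open>An increasing geometric sum is dominated by its term of greatest index, so a bound on
  single terms again bounds the sum.\<close>

lemma sum_inverse_power_le_of_bound: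
  fixes r :: real
  assumes r: "0 < r" "r < 1" and I: "finite I" and B: "0 \<le> B" "\<And>n. n \<in> I \<Longrightarrow> (1 / r) ^ n \<le> B"
  shows "(\<Sum>n\<in>I. (1 / r) ^ n) \<le> B / (1 - r)"
proof (cases "I = {}")
  case True
  then show ?thesis using r B by simp
next
  case False
  define m where "m = Max I"
  have m: "m \<in> I" "\<And>n. n \<in> I \<Longrightarrow> n \<le> m" using I False by (auto simp: m_def)
  have 1: "x = y" if "m - x = m - y" "x \<in> I" "y \<in> I" for x y using that m(2) by (metis diff_diff_cancel)
  have "(1 / r) ^ n = (1 / r) ^ m * r ^ (m - n)" if "n \<in> I" for n
    using m(2)[OF that] r by (simp add: power_diff power_one_over field_simps)
  then have "(\<Sum>n\<in>I. (1 / r) ^ n) = (\<Sum>n\<in>I. (1 / r) ^ m * r ^ (m - n))"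
    by (intro sum.cong) auto
  also have "\<dots> = (1 / r) ^ m * (\<Sum>k\<in>(\<lambda>n. m - n) ` I. r ^ k)"
    unfolding sum_distrib_left by (subst sum.reindex) (auto intro!: inj_onI dest: 1)
  also have "\<dots> \<le> B * (1 / (1 - r))"
    using r B(1) B(2)[OF m(1)] I by (intro mult_mono sum_geometric_subset_le) (auto intro!: sum_nonneg)
  finally show ?thesis by simp
qed

text \<open>The two entries of the minimum cross where \<open>l ^ n\<close> is about A / (4 y^2).
  Before the crossover the square root is the smaller one and the terms grow like l^(-n/2); after it
  2 y is, and they decay like l^(n (s - 1)). Both sums are controlled by their value at the
  crossover, which is a multiple of y A^(s - 1).\<close>

lemma sum_min_powr_le:
  fixes l s y A :: real
  assumes l: "0 < l" "l < 1" and s: "1 < s" and y: "0 < y" and A: "0 < A" and I: "finite I"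
  shows "(\<Sum>n\<in>I. min (2 * y) (sqrt (A / l ^ n)) powr (2 * s - 1) * (l ^ n) powr (s - 1))
    \<le> 2 * y * A powr (s - 1) * (1 / (1 - sqrt l) + 1 / (1 - l powr (s - 1)))" (is "sum ?T I \<le> _")
proof -
  define I1 where "I1 = {n \<in> I. A \<le> 4 * y\<^sup>2 * l ^ n}"
  define I2 where "I2 = {n \<in> I. 4 * y\<^sup>2 * l ^ n < A}"
  have fin: "finite I1" "finite I2" and un: "I = I1 \<union> I2" "I1 \<inter> I2 = {}"
    using I by (auto simp: I1_def I2_def)
  have r1: "0 < sqrt l" "sqrt l < 1" using l by auto
  have r2: "0 < l powr (s - 1)" "l powr (s - 1) < 1"
    using l s powr_less_mono2[of "s - 1" l 1] by auto
  have sqrtA: "A powr (s - 1/2) = A powr (s - 1) * sqrt A"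
    using A by (simp add: powr_half_sqrt[symmetric] powr_add[symmetric])
  have "sum ?T I1 \<le> (\<Sum>n\<in>I1. A powr (s - 1/2) * (1 / sqrt l) ^ n)"
  proof (rule sum_mono)
    fix n
    have x: "0 < l ^ n" using l by simp
    have "?T n \<le> sqrt (A / l ^ n) powr (2 * s - 1) * (l ^ n) powr (s - 1)"
      using s x A y by (intro mult_right_mono powr_mono2) auto
    also have "sqrt (A / l ^ n) powr (2 * s - 1) = (A / l ^ n) powr (s - 1/2)"
      using A x by (simp add: powr_half_sqrt[symmetric] powr_powr algebra_simps)
    also have "(A / l ^ n) powr (s - 1/2) * (l ^ n) powr (s - 1) = A powr (s - 1/2) * (l ^ n) powr (-1/2)"
    proof -
      have "(l ^ n) powr (s - 1) = (l ^ n) powr (s - 1/2) * (l ^ n) powr (-1/2)"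
        by (simp flip: powr_add)
      then show ?thesis using A x by (simp add: powr_divide)
    qed
    also have "(l ^ n) powr (-1/2) = (1 / sqrt l) ^ n"
      using x l by (simp add: powr_minus_divide powr_half_sqrt real_sqrt_power power_one_over)
    finally show "?T n \<le> A powr (s - 1/2) * (1 / sqrt l) ^ n" .
  qed
  also have "\<dots> = A powr (s - 1/2) * (\<Sum>n\<in>I1. (1 / sqrt l) ^ n)" by (simp add: sum_distrib_left)
  \<comment> \<open>Membership in \<open>I1\<close> caps the growing powers at the crossover value
    \<open>2 * y / sqrt A\<close>.\<close>
  also have "\<dots> \<le> A powr (s - 1/2) * (2 * y / sqrt A / (1 - sqrt l))"
  proof (intro mult_left_mono sum_inverse_power_le_of_bound r1 fin)
    fix n assume "n \<in> I1"
    then have "sqrt A \<le> sqrt (4 * y\<^sup>2 * l ^ n)" by (simp add: I1_def)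
    also have "\<dots> = 2 * y * sqrt l ^ n" using y by (simp add: real_sqrt_mult real_sqrt_power)
    finally show "(1 / sqrt l) ^ n \<le> 2 * y / sqrt A"
      using A l by (simp add: power_one_over field_simps)
  qed (use A y in auto)
  also have "\<dots> = 2 * y * A powr (s - 1) * (1 / (1 - sqrt l))"
    unfolding sqrtA using A r1 by (simp add: field_simps)
  finally have 1: "sum ?T I1 \<le> 2 * y * A powr (s - 1) * (1 / (1 - sqrt l))" .
  have "sum ?T I2 \<le> (\<Sum>n\<in>I2. (2 * y) powr (2 * s - 1) * (l powr (s - 1)) ^ n)"
  proof (rule sum_mono)
    fix n
    have x: "0 < l ^ n" using l by simp
    have le: "?T n \<le> (2 * y) powr (2 * s - 1) * (l ^ n) powr (s - 1)"
      using s x A y by (intro mult_right_mono powr_mono2) auto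
    have "(l powr (s - 1)) ^ n = (l ^ n) powr (s - 1)"
      using l by (simp add: powr_realpow[symmetric] powr_powr mult.commute)
    then show "?T n \<le> (2 * y) powr (2 * s - 1) * (l powr (s - 1)) ^ n"
      using le by (simp only:)
  qed
  also have "\<dots> = (2 * y) powr (2 * s - 1) * (\<Sum>n\<in>I2. (l powr (s - 1)) ^ n)" by (simp add: sum_distrib_left)
  \<comment> \<open>Membership in \<open>I2\<close> caps \<open>l ^ n\<close> at A / (2 y)^2; since
    s > 1, the ratio \<open>l powr (s - 1)\<close> is below 1.\<close>
  also have "\<dots> \<le> (2 * y) powr (2 * s - 1) * ((A / (2 * y)\<^sup>2) powr (s - 1) / (1 - l powr (s - 1)))"
  proof (intro mult_left_mono sum_power_le_of_bound r2 fin)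
    fix n assume "n \<in> I2"
    then have "l ^ n \<le> A / (2 * y)\<^sup>2" using y by (simp add: I2_def field_simps power2_eq_square)
    then have "(l ^ n) powr (s - 1) \<le> (A / (2 * y)\<^sup>2) powr (s - 1)"
      using l s by (intro powr_mono2) auto
    then show "(l powr (s - 1)) ^ n \<le> (A / (2 * y)\<^sup>2) powr (s - 1)"
      using l by (simp add: powr_realpow[symmetric] powr_powr mult.commute)
  qed auto
  also have "\<dots> = 2 * y * A powr (s - 1) * (1 / (1 - l powr (s - 1)))"
  proof -
    have "(2 * y) powr (2 * s - 1) = 2 * y * (2 * y) powr (2 * (s - 1))"
      using y powr_add[of "2 * y" 1 "2 * (s - 1)"] by (simp add: algebra_simps)
    moreover have "((2 * y)\<^sup>2) powr (s - 1) = (2 * y) powr (2 * (s - 1))"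
    proof -
      have "(2 * y)\<^sup>2 = (2 * y) powr 2" using y by simp
      then show ?thesis by (simp only: powr_powr)
    qed
    ultimately have "(2 * y) powr (2 * s - 1) * (A / (2 * y)\<^sup>2) powr (s - 1) = 2 * y * A powr (s - 1)"
      using y A by (simp add: powr_divide)
    then show ?thesis by simp
  qed
  finally have 2: "sum ?T I2 \<le> 2 * y * A powr (s - 1) * (1 / (1 - l powr (s - 1)))" .
  have "sum ?T I = sum ?T I1 + sum ?T I2"
    unfolding un(1) using fin un(2) by (rule sum.union_disjoint)
  then show ?thesis using 1 2 by (simp add: distrib_left)
qed

section \<open>Chords of the unit circle\<close>

lemma half_le_sin:
  assumes "0 \<le> x" "x \<le> pi / 2"
  shows "x / 2 \<le> sin x"
\<comment> \<open>Up to pi / 3 the cosine is at least 1/2 and the mean value theorem applies; beyond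
  it, sin x \<ge> sqrt 3 / 2 > 4/5, while x / 2 \<le> pi / 4 < 4/5.\<close>
proof (cases "x \<le> pi / 3")
  case True
  show ?thesis
  proof (cases "x = 0")
    case False
    then obtain z where z: "0 < z" "z < x" "sin x - sin 0 = (x - 0) * cos z"
      using MVT2[of 0 x sin cos] assms by (auto intro!: derivative_eq_intros)
    have "1 / 2 \<le> cos z"
      using cos_monotone_0_pi_le[of z "pi / 3"] z True pi_gt_zero by (simp add: cos_60)
    then have "x * (1 / 2) \<le> x * cos z" using assms by (intro mult_left_mono) auto
    then show ?thesis using z(3) by simp
  qed simp
next
  case False
  have "sin (pi / 3) \<le> sin x"
    using False assms by (intro sin_monotone_2pi_le) auto
  moreover have "8 / 5 < sqrt 3" by (rule real_less_rsqrt) (simp add: power2_eq_square)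
  moreover have "x / 2 \<le> 4 / 5" using assms pi_approx(2) by simp
  ultimately show ?thesis by (simp add: sin_60)
qed

lemma norm_cis_diff: "norm (cis a - cis b) = 2 * \<bar>sin ((a - b) / 2)\<bar>"
proof -
  have "cis a - cis b = cis b * (cis (a - b) - 1)"
    by (simp add: algebra_simps cis_mult)
  then have "norm (cis a - cis b) = norm (cis (a - b) - 1)" by (simp only: norm_mult norm_cis mult_1_left)
  then show ?thesis using dist_exp_i_1[of "a - b"] by (simp add: cis_conv_exp)
qed

lemma norm_cis_diff_le: "norm (cis a - cis b) \<le> \<bar>a - b\<bar>"
  unfolding norm_cis_diff using abs_sin_x_le_abs_x[of "(a - b) / 2"] by simp

lemma norm_cis_diff_ge:
  assumes "\<bar>a - b\<bar> \<le> pi"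
  shows "\<bar>a - b\<bar> / 2 \<le> norm (cis a - cis b)"
proof -
  have "\<bar>a - b\<bar> / 4 \<le> sin (\<bar>a - b\<bar> / 2)" using half_le_sin[of "\<bar>a - b\<bar> / 2"] assms by simp
  also have "\<bar>a - b\<bar> / 2 = \<bar>(a - b) / 2\<bar>" by simp
  also have "sin \<bar>(a - b) / 2\<bar> \<le> \<bar>sin ((a - b) / 2)\<bar>"
    by (cases "0 \<le> (a - b) / 2") (simp_all only: abs_of_nonneg abs_of_neg not_le sin_minus abs_ge_self abs_ge_minus_self)
  finally show ?thesis unfolding norm_cis_diff by simp
qed

text \<open>The argument measured from the direction \<open>\<theta>\<close>, with its sign split
  off so that the angular distance \<open>\<beta>\<close> can be counted in equal steps on either
  side.\<close>

lemma polar_around: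
  obtains \<beta> \<sigma> :: real where "0 \<le> \<beta>" "\<beta> \<le> pi" "\<sigma> = 1 \<or> \<sigma> = -1" "w = norm w * cis (\<theta> + \<sigma> * \<beta>)"
proof -
  define v where "v = w * cis (- \<theta>)"
  have nv: "norm v = norm w" by (simp add: v_def norm_mult)
  have "v = of_real (norm v) * cis (Arg v)" using rcis_cmod_Arg[of v] by (simp add: rcis_def)
  then have "v * cis \<theta> = of_real (norm w) * cis (Arg v) * cis \<theta>" by (simp only: nv)
  moreover have "v * cis \<theta> = w" by (simp add: v_def mult.assoc cis_mult)
  ultimately have w: "w = norm w * cis (\<theta> + Arg v)" by (simp add: mult.assoc cis_mult add.commute)
  show ?thesis
    by (rule that[of "\<bar>Arg v\<bar>" "if Arg v \<ge> 0 then 1 else -1"])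
       (use Arg_bounded[of v] w in \<open>auto simp: abs_if\<close>)
qed

section \<open>Whitney-bounded measures on the disc\<close>

text \<open>The Whitney condition on the unit disc: 1 - |w| is the distance to the boundary, and the
  radii are a fixed proportion of it.\<close>

definition whitney_bound :: "real \<Rightarrow> real \<Rightarrow> real \<Rightarrow> complex measure \<Rightarrow> bool" where
  "whitney_bound \<kappa> s c \<nu> \<longleftrightarrow> (\<forall>w. norm w < 1 \<longrightarrow>
     emeasure \<nu> (ball w (\<kappa> * (1 - norm w))) \<le> ennreal (c * (1 - norm w) powr s))"

text \<open>The annulus is covered by balls of radius \<kappa> \<tau> centred on |w| = 1 - \<tau> at
  angles \<theta> \<plusminus> j \<kappa> \<tau> / 2. Each has mass at most c \<tau>^s, and on the
  part of the annulus assigned to index j the distance to cis \<theta> is at least a multiple of (j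
  + 1) \<tau>. The sum of 1 / (j + 1)^2 converges, which leaves \<tau>^(s - 2).\<close>

lemma annulus_poisson_integral_le:
  fixes \<nu> :: "complex measure"
  assumes sets: "sets \<nu> = sets (restrict_space borel (ball 0 1))"
    and \<kappa>: "0 < \<kappa>" "\<kappa> < 1" and c: "0 < c" and bound: "whitney_bound \<kappa> s c \<nu>"
    and \<tau>: "0 < \<tau>" "\<tau> \<le> 1"
  shows "(\<integral>\<^sup>+w. indicator {w. (1 - \<kappa> / 4) * \<tau> < 1 - norm w \<and> 1 - norm w \<le> \<tau>} w *
        ennreal (1 / (norm (cis \<theta> - w))\<^sup>2) \<partial>\<nu>)
    \<le> ennreal (256 * pi\<^sup>2 * c / (3 * \<kappa>\<^sup>2) * \<tau> powr (s - 2))"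
proof -
  define \<eta> where "\<eta> = \<kappa> / 2"
  have \<eta>: "0 < \<eta>" "\<eta> < 1" using \<kappa> by (auto simp: \<eta>_def)
  define B where "B = (\<lambda>(\<sigma>::real) (j::nat). ball (of_real (1 - \<tau>) * cis (\<theta> + \<sigma> * (real j * \<eta> * \<tau>))) (\<kappa> * \<tau>))"
  define a where "a = (\<lambda>j::nat. 64 / (\<eta>\<^sup>2 * \<tau>\<^sup>2 * (real j + 1)\<^sup>2))"
  have centre: "norm (of_real (1 - \<tau>) * cis x) = 1 - \<tau>" for x
    using \<tau> by (simp only: norm_mult norm_of_real norm_cis) simp
  have B_sub: "B \<sigma> j \<subseteq> ball 0 1" for \<sigma> j
  proof
    fix w assume "w \<in> B \<sigma> j"
    then have "norm (of_real (1 - \<tau>) * cis (\<theta> + \<sigma> * (real j * \<eta> * \<tau>)) - w) < \<kappa> * \<tau>"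
      by (simp add: B_def dist_norm)
    then have "norm w < (1 - \<tau>) + \<kappa> * \<tau>"
      using norm_triangle_sub[of w "of_real (1 - \<tau>) * cis (\<theta> + \<sigma> * (real j * \<eta> * \<tau>))"] centre
      by (simp add: norm_minus_commute)
    also have "\<dots> \<le> 1" using \<kappa> \<tau> by (simp add: mult_le_cancel_right1)
    finally show "w \<in> ball 0 1" by simp
  qed
  have B_sets [measurable]: "B \<sigma> j \<in> sets \<nu>" for \<sigma> j
    unfolding sets using B_sub by (auto simp: sets_restrict_space_iff B_def)
  have B_le: "emeasure \<nu> (B \<sigma> j) \<le> ennreal (c * \<tau> powr s)" for \<sigma> j
    using bound[unfolded whitney_bound_def, rule_format, of "of_real (1 - \<tau>) * cis (\<theta> + \<sigma> * (real j * \<eta> * \<tau>))"]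
    unfolding centre B_def using \<tau> by simp
  have pt: "indicator {w. (1 - \<kappa> / 4) * \<tau> < 1 - norm w \<and> 1 - norm w \<le> \<tau>} w * ennreal (1 / (norm (cis \<theta> - w))\<^sup>2)
      \<le> (\<Sum>j. ennreal (a j) * indicator (B 1 j) w + ennreal (a j) * indicator (B (-1) j) w)" for w
  proof (cases "(1 - \<kappa> / 4) * \<tau> < 1 - norm w \<and> 1 - norm w \<le> \<tau>")
    case True
    obtain \<beta> \<sigma> where \<beta>: "0 \<le> \<beta>" "\<beta> \<le> pi" "\<sigma> = 1 \<or> \<sigma> = (-1::real)" "w = norm w * cis (\<theta> + \<sigma> * \<beta>)"
      by (rule polar_around)
    define j where "j = nat \<lfloor>\<beta> / (\<eta> * \<tau>)\<rfloor>"
    have \<eta>\<tau>: "0 < \<eta> * \<tau>" using \<eta> \<tau> by simp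
    have "real j \<le> \<beta> / (\<eta> * \<tau>)" "\<beta> / (\<eta> * \<tau>) < real j + 1"
      using \<beta>(1) \<eta>\<tau> by (auto simp: j_def)
    then have j: "real j * \<eta> * \<tau> \<le> \<beta>" "\<beta> < real j * \<eta> * \<tau> + \<eta> * \<tau>"
      using \<eta>\<tau> by (auto simp: field_simps)
    have wB: "w \<in> B \<sigma> j"
    proof -
      let ?x = "\<theta> + \<sigma> * (real j * \<eta> * \<tau>)"
      have "w - of_real (1 - \<tau>) * cis ?x =
          of_real (norm w - (1 - \<tau>)) * cis (\<theta> + \<sigma> * \<beta>) + of_real (1 - \<tau>) * (cis (\<theta> + \<sigma> * \<beta>) - cis ?x)"
        by (subst \<beta>(4)) (simp add: algebra_simps)
      then have "norm (w - of_real (1 - \<tau>) * cis ?x) \<le>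
          norm (of_real (norm w - (1 - \<tau>)) * cis (\<theta> + \<sigma> * \<beta>)) + norm (of_real (1 - \<tau>) * (cis (\<theta> + \<sigma> * \<beta>) - cis ?x))"
        by (metis norm_triangle_ineq)
      also have "\<dots> = \<bar>norm w - (1 - \<tau>)\<bar> + (1 - \<tau>) * norm (cis (\<theta> + \<sigma> * \<beta>) - cis ?x)"
        using \<tau> by (simp only: norm_mult norm_of_real norm_cis) simp
      also have "\<dots> \<le> \<kappa> / 4 * \<tau> + 1 * (\<eta> * \<tau>)"
      proof (intro add_mono mult_mono)
        show "\<bar>norm w - (1 - \<tau>)\<bar> \<le> \<kappa> / 4 * \<tau>" using True by (simp add: algebra_simps)
        have "norm (cis (\<theta> + \<sigma> * \<beta>) - cis ?x) \<le> \<bar>\<sigma> * \<beta> - \<sigma> * (real j * \<eta> * \<tau>)\<bar>"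
          using norm_cis_diff_le[of "\<theta> + \<sigma> * \<beta>" ?x] by simp
        also have "\<dots> \<le> \<eta> * \<tau>" using \<beta>(3) j by auto
        finally show "norm (cis (\<theta> + \<sigma> * \<beta>) - cis ?x) \<le> \<eta> * \<tau>" .
      qed (use \<tau> in auto)
      \<comment> \<open>The radial error is at most \<kappa> \<tau> / 4 by the thinness of the
        annulus, the angular error at most \<kappa> \<tau> / 2 by the step length.\<close>
      also have "\<dots> < \<kappa> * \<tau>" using \<kappa> \<tau> by (simp add: \<eta>_def field_simps)
      finally show ?thesis by (simp add: B_def dist_norm norm_minus_commute)
    qed
    \<comment> \<open>Let D be the distance from cis \<theta> to w. The chord estimate gives \<beta>
      \<le> 4 D and the radial gap gives \<tau> \<le> 2 D; the latter supplies the + 1, which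
      matters for j = 0. Together \<eta> \<tau> (j + 1) \<le> 6 D.\<close>
    have low: "\<eta> * \<tau> * (real j + 1) / 8 \<le> norm (cis \<theta> - w)"
    proof -
      have 1: "1 - norm w \<le> norm (cis \<theta> - w)"
        using norm_triangle_ineq2[of "cis \<theta>" w] by simp
      have "\<beta> / 2 \<le> norm (cis (\<theta> + \<sigma> * \<beta>) - cis \<theta>)"
        using norm_cis_diff_ge[of "\<theta> + \<sigma> * \<beta>" \<theta>] \<beta> by auto
      also have "cis (\<theta> + \<sigma> * \<beta>) - cis \<theta> = of_real (1 - norm w) * cis (\<theta> + \<sigma> * \<beta>) + (w - cis \<theta>)"
        by (subst (2) \<beta>(4)) (simp add: algebra_simps)
      also have "norm \<dots> \<le> norm (of_real (1 - norm w) * cis (\<theta> + \<sigma> * \<beta>)) + norm (w - cis \<theta>)"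
        by (rule norm_triangle_ineq)
      also have "norm (of_real (1 - norm w) * cis (\<theta> + \<sigma> * \<beta>)) = \<bar>1 - norm w\<bar>"
        by (simp only: norm_mult norm_of_real norm_cis) simp
      also have "\<bar>1 - norm w\<bar> = 1 - norm w"
      proof -
        have "0 < (1 - \<kappa> / 4) * \<tau>" using \<kappa> \<tau> by simp
        then show ?thesis using True by linarith
      qed
      finally have 2: "\<beta> / 2 \<le> 2 * norm (cis \<theta> - w)" using 1 by (simp add: norm_minus_commute)
      have "\<tau> / 2 \<le> (1 - \<kappa> / 4) * \<tau>" using \<kappa> \<tau> by (simp add: field_simps)
      then have "\<tau> / 2 \<le> norm (cis \<theta> - w)" using True 1 by linarith
      moreover have "\<eta> * \<tau> \<le> \<tau>" using \<eta> \<tau> by simp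
      ultimately show ?thesis using 2 j by (simp add: algebra_simps)
    qed
    have "1 / (norm (cis \<theta> - w))\<^sup>2 \<le> 1 / (\<eta> * \<tau> * (real j + 1) / 8)\<^sup>2"
    proof -
      have "0 < \<eta> * \<tau> * (real j + 1) / 8" using \<eta>\<tau> by simp
      then show ?thesis using low
        by (intro divide_left_mono power_mono mult_pos_pos zero_less_power) linarith+
    qed
    also have "\<dots> = a j" by (simp add: a_def power_mult_distrib power_divide)
    finally have le: "ennreal (1 / (norm (cis \<theta> - w))\<^sup>2) \<le> ennreal (a j)" by (rule ennreal_leI)
    let ?f = "\<lambda>j. ennreal (a j) * indicator (B 1 j) w + ennreal (a j) * indicator (B (-1) j) w"
    have "ennreal (a j) \<le> ?f j"
      using \<beta>(3) wB by (auto simp: indicator_def)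
    also have "?f j = (\<Sum>i\<in>{j}. ?f i)" by simp
    also have "\<dots> \<le> (\<Sum>i. ?f i)"
      by (rule sum_le_suminf) auto
    finally show ?thesis using le True by (simp add: indicator_def)
  qed (auto simp: indicator_def)
  have "(\<integral>\<^sup>+w. indicator {w. (1 - \<kappa> / 4) * \<tau> < 1 - norm w \<and> 1 - norm w \<le> \<tau>} w * ennreal (1 / (norm (cis \<theta> - w))\<^sup>2) \<partial>\<nu>)
      \<le> (\<integral>\<^sup>+w. (\<Sum>j. ennreal (a j) * indicator (B 1 j) w + ennreal (a j) * indicator (B (-1) j) w) \<partial>\<nu>)"
    by (intro nn_integral_mono pt)
  also have "\<dots> = (\<Sum>j. ennreal (a j) * emeasure \<nu> (B 1 j) + ennreal (a j) * emeasure \<nu> (B (-1) j))"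
    by (subst nn_integral_suminf) (auto simp: nn_integral_add nn_integral_cmult)
  also have "\<dots> \<le> (\<Sum>j. ennreal (a j) * ennreal (c * \<tau> powr s) + ennreal (a j) * ennreal (c * \<tau> powr s))"
    by (intro suminf_le add_mono mult_left_mono B_le) auto
  also have "\<dots> = (\<Sum>j. ennreal (128 * c * \<tau> powr s / (\<eta>\<^sup>2 * \<tau>\<^sup>2) * (1 / (real j + 1)\<^sup>2)))"
  proof (intro suminf_cong)
    fix j
    have "0 \<le> a j" "0 \<le> c * \<tau> powr s" using c \<eta> \<tau> by (auto simp: a_def)
    then have "ennreal (a j) * ennreal (c * \<tau> powr s) + ennreal (a j) * ennreal (c * \<tau> powr s) = ennreal (2 * (a j * (c * \<tau> powr s)))"
      by (simp only: mult_2 ennreal_plus ennreal_mult mult_nonneg_nonneg)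
    also have "2 * (a j * (c * \<tau> powr s)) = 128 * c * \<tau> powr s / (\<eta>\<^sup>2 * \<tau>\<^sup>2) * (1 / (real j + 1)\<^sup>2)"
      by (simp add: a_def)
    finally show "ennreal (a j) * ennreal (c * \<tau> powr s) + ennreal (a j) * ennreal (c * \<tau> powr s) =
      ennreal (128 * c * \<tau> powr s / (\<eta>\<^sup>2 * \<tau>\<^sup>2) * (1 / (real j + 1)\<^sup>2))" .
  qed
  also have "\<dots> = ennreal (128 * c * \<tau> powr s / (\<eta>\<^sup>2 * \<tau>\<^sup>2) * (pi\<^sup>2 / 6))"
  proof (rule suminf_ennreal_eq)
    have "(\<lambda>n. 1 / (real n + 1)\<^sup>2) sums (pi\<^sup>2 / 6)" using inverse_squares_sums by (simp add: add.commute)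
    then show "(\<lambda>j. 128 * c * \<tau> powr s / (\<eta>\<^sup>2 * \<tau>\<^sup>2) * (1 / (real j + 1)\<^sup>2)) sums (128 * c * \<tau> powr s / (\<eta>\<^sup>2 * \<tau>\<^sup>2) * (pi\<^sup>2 / 6))"
      by (rule sums_mult)
  qed (use c in auto)
  also have "128 * c * \<tau> powr s / (\<eta>\<^sup>2 * \<tau>\<^sup>2) * (pi\<^sup>2 / 6) = 256 * pi\<^sup>2 * c / (3 * \<kappa>\<^sup>2) * \<tau> powr (s - 2)"
    using \<tau> by (simp add: \<eta>_def powr_diff power_divide field_simps)
  finally show ?thesis .
qed

text \<open>Needed for exchanging integrals: by Lindelof countably many of the balls in the Whitney
  bound cover the disc, each of finite mass.\<close>

lemma sigma_finite_of_whitney_bound: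
  fixes \<nu> :: "complex measure"
  assumes sets: "sets \<nu> = sets (restrict_space borel (ball 0 1))"
    and \<kappa>: "0 < \<kappa>" "\<kappa> < 1" and bound: "whitney_bound \<kappa> s c \<nu>"
  shows "sigma_finite_measure \<nu>"
proof -
  have space: "space \<nu> = ball 0 1" using sets_eq_imp_space_eq[OF sets] by (simp add: space_restrict_space)
  define \<F> where "\<F> = (\<lambda>w. ball w (\<kappa> * (1 - norm w))) ` ball (0::complex) 1"
  have sub: "ball w (\<kappa> * (1 - norm w)) \<subseteq> ball 0 1" if "norm w < 1" for w :: complex
  proof -
    have "\<kappa> * (1 - norm w) \<le> 1 * (1 - norm w)" using that \<kappa> by (intro mult_right_mono) auto
    then show ?thesis by (simp add: ball_subset_ball_iff)
  qed
  have op: "\<And>S. S \<in> \<F> \<Longrightarrow> open S" by (auto simp: \<F>_def)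
  obtain \<F>' where \<F>': "\<F>' \<subseteq> \<F>" "countable \<F>'" "\<Union>\<F>' = \<Union>\<F>" using Lindelof[OF op] by metis
  have un: "\<Union>\<F> = ball 0 1"
  proof
    show "\<Union>\<F> \<subseteq> ball 0 1" using sub by (force simp: \<F>_def)
    have "w \<in> ball w (\<kappa> * (1 - norm w))" if "norm w < 1" for w :: complex using \<kappa> that by simp
    then show "ball 0 1 \<subseteq> \<Union>\<F>" unfolding \<F>_def by force
  qed
  show ?thesis
  proof
    show "\<exists>A. countable A \<and> A \<subseteq> sets \<nu> \<and> \<Union>A = space \<nu> \<and> (\<forall>a\<in>A. emeasure \<nu> a \<noteq> \<infinity>)"
    proof (intro exI[of _ \<F>'] conjI ballI)
      show "\<F>' \<subseteq> sets \<nu>"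
        unfolding sets using \<F>'(1) sub by (force simp: \<F>_def sets_restrict_space_iff)
      fix S assume "S \<in> \<F>'"
      then obtain w where "norm w < 1" "S = ball w (\<kappa> * (1 - norm w))" using \<F>'(1) by (auto simp: \<F>_def)
      then show "emeasure \<nu> S \<noteq> \<infinity>"
        using bound by (auto simp: whitney_bound_def top_unique)
    qed (use \<F>' un space in auto)
  qed
qed

section \<open>Hardy functions on circles inside the disc\<close>

lemma exists_zero_free_circle:
  assumes hol: "g holomorphic_on ball 0 1" and nz: "\<exists>z\<in>ball 0 1. g z \<noteq> 0" and r: "0 < r" "r < 1"
  obtains \<rho> where "r < \<rho>" "\<rho> < 1" "\<And>z. norm z = \<rho> \<Longrightarrow> g z \<noteq> 0"
proof -
  define R where "R = (r + 1) / 2"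
  have R: "r < R" "R < 1" using r by (auto simp: R_def)
  have "finite {z \<in> cball 0 R. g z = 0}"
  proof (cases "g constant_on ball 0 1")
    case True
    then have "{z \<in> cball 0 R. g z = 0} = {}" using nz R by (force simp: constant_on_def)
    then show ?thesis by (metis finite.emptyI)
  next
    case False
    then show ?thesis by (intro holomorphic_compact_finite_zeros[OF hol]) (use R in auto)
  qed
  \<comment> \<open>Finitely many zeros occupy finitely many radii, while the interval of admissible
    radii is infinite.\<close>
  then have "finite (norm ` {z \<in> cball 0 R. g z = 0})" by simp
  moreover have "infinite {r<..<R}" using R by (simp add: infinite_Ioo)
  ultimately obtain \<rho> where "\<rho> \<in> {r<..<R}" "\<rho> \<notin> norm ` {z \<in> cball 0 R. g z = 0}"
    by (meson finite_subset subsetI)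
  then show ?thesis using that[of \<rho>] R by force
qed

text \<open>The condition on \<open>w\<close> says 1 - \<rho> \<le> \<rho> - |w|, so replacing the
  point \<rho> cis \<theta> by cis \<theta> at most doubles its distance to \<open>w\<close>. The
  bounds no longer depend on \<open>\<rho>\<close>.\<close>

lemma poisson_kernel_le:
  assumes w: "norm w \<le> 2 * \<rho> - 1" and \<rho>: "\<rho> < 1"
  shows "poisson_kernel \<rho> w \<theta> \<le> 4 / pi * (1 - norm w) / (norm (cis \<theta> - w))\<^sup>2"
    and "poisson_kernel \<rho> w \<theta> \<le> 4 / pi / (1 - norm w)"
proof -
  have w1: "norm w < \<rho>" "norm w < 1" using w \<rho> by auto
  have \<rho>0: "0 < \<rho>" using w1 norm_ge_zero[of w] by linarith
  have "\<rho> - norm w \<le> norm (\<rho> * cis \<theta> - w)"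
    using norm_triangle_ineq2[of "\<rho> * cis \<theta>" w] \<rho>0 by (simp add: norm_mult)
  moreover have "norm (cis \<theta> - w) \<le> (1 - \<rho>) + norm (\<rho> * cis \<theta> - w)"
  proof -
    have "cis \<theta> - w = of_real (1 - \<rho>) * cis \<theta> + (\<rho> * cis \<theta> - w)" by (simp add: algebra_simps)
    then have "norm (cis \<theta> - w) \<le> norm (of_real (1 - \<rho>) * cis \<theta>) + norm (\<rho> * cis \<theta> - w)"
      by (metis norm_triangle_ineq)
    also have "norm (of_real (1 - \<rho>) * cis \<theta>) = 1 - \<rho>"
      using \<rho> by (simp only: norm_mult norm_of_real norm_cis) simp
    finally show ?thesis .
  qed
  ultimately have d: "norm (cis \<theta> - w) \<le> 2 * norm (\<rho> * cis \<theta> - w)" using w by linarith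
  have pos: "1 - norm w \<le> norm (cis \<theta> - w)"
    using norm_triangle_ineq2[of "cis \<theta>" w] by simp
  then have pos': "0 < norm (cis \<theta> - w)" using w1 by linarith
  have num: "\<rho>\<^sup>2 - (norm w)\<^sup>2 \<le> 2 * (1 - norm w)"
  proof -
    have "\<rho>\<^sup>2 - (norm w)\<^sup>2 = (\<rho> + norm w) * (\<rho> - norm w)" by (simp add: power2_eq_square algebra_simps)
    also have "\<dots> \<le> 2 * (1 - norm w)" using w1 \<rho> \<rho>0 by (intro mult_mono) auto
    finally show ?thesis .
  qed
  have "poisson_kernel \<rho> w \<theta> \<le> 2 * (1 - norm w) / (2 * pi * (norm (cis \<theta> - w) / 2)\<^sup>2)"
    unfolding poisson_kernel_def
    using num d pos' w1 by (intro frac_le mult_left_mono power_mono) auto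
  also have "\<dots> = 4 / pi * (1 - norm w) / (norm (cis \<theta> - w))\<^sup>2" by (simp add: power_divide)
  finally show 1: "poisson_kernel \<rho> w \<theta> \<le> 4 / pi * (1 - norm w) / (norm (cis \<theta> - w))\<^sup>2" .
  also have "\<dots> \<le> 4 / pi * (1 - norm w) / (1 - norm w)\<^sup>2"
    using pos w1 by (intro divide_left_mono power_mono mult_pos_pos zero_less_power pos') auto
  also have "\<dots> = 4 / pi / (1 - norm w)" 
  proof -
    have "4 / pi * x / x\<^sup>2 = 4 / pi / x" if "x \<noteq> 0" for x :: real
      using that by (simp add: power2_eq_square)
    from this[of "1 - norm w"] show ?thesis using w1 by linarith
  qed
  finally show "poisson_kernel \<rho> w \<theta> \<le> 4 / pi / (1 - norm w)" .
qed

lemma hardy_circle_le: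
  fixes \<rho> :: real
  assumes "in_hardy_disc p g" "0 < \<rho>" "\<rho> < 1"
  shows "(\<integral>\<^sup>+\<theta>\<in>{0..2*pi}. ennreal (norm (g (\<rho> * cis \<theta>)) powr p) \<partial>lborel)
    \<le> ennreal (2 * pi * enn2real (hardy_disc_pnorm p g))"
proof -
  have fin: "hardy_disc_pnorm p g < \<infinity>" using assms by (simp add: in_hardy_disc_def)
  let ?X = "\<integral>\<^sup>+\<theta>\<in>{0..2*pi}. ennreal (norm (g (\<rho> * cis \<theta>)) powr p) \<partial>lborel"
  have "ennreal (1 / (2 * pi)) * ?X \<le> hardy_disc_pnorm p g"
    unfolding hardy_disc_pnorm_def using assms by (intro SUP_upper) auto
  then have "ennreal (2 * pi) * (ennreal (1 / (2 * pi)) * ?X) \<le> ennreal (2 * pi) * hardy_disc_pnorm p g"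
    by (rule mult_left_mono) simp
  also have "ennreal (2 * pi) * (ennreal (1 / (2 * pi)) * ?X) = ?X"
    by (simp add: mult.assoc[symmetric] ennreal_mult[symmetric])
  also have "ennreal (2 * pi) * hardy_disc_pnorm p g = ennreal (2 * pi * enn2real (hardy_disc_pnorm p g))"
    using fin by (simp add: ennreal_mult)
  finally show ?thesis .
qed

lemma continuous_on_circle:
  fixes \<rho> :: real
  assumes "g holomorphic_on ball 0 1" "0 < \<rho>" "\<rho> < 1"
  shows "continuous_on A (\<lambda>\<theta>. g (\<rho> * cis \<theta>))"
  by (rule continuous_on_compose2[OF holomorphic_on_imp_continuous_on[OF assms(1)]])
     (use assms in \<open>auto intro!: continuous_intros simp: norm_mult\<close>)

text \<open>The kernel is at most (4 / pi) / (1 - |w|) and the circle integral of |g|^p at most 2 pi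
  N; their product is the bound.\<close>

lemma hardy_pointwise_le:
  assumes g: "in_hardy_disc p g" and p: "0 < p" and w: "norm w \<le> 2 * \<rho> - 1" and \<rho>: "\<rho> < 1"
    and nz: "\<And>z. norm z = \<rho> \<Longrightarrow> g z \<noteq> 0"
  shows "norm (g w) powr p \<le> 8 * enn2real (hardy_disc_pnorm p g) / (1 - norm w)"
proof -
  let ?N = "enn2real (hardy_disc_pnorm p g)"
  have w1: "norm w < \<rho>" "norm w < 1" using w \<rho> by auto
  have \<rho>0: "0 < \<rho>" using w1 norm_ge_zero[of w] by linarith
  have hol: "g holomorphic_on ball 0 1" using g by (simp add: in_hardy_disc_def)
  let ?f = "\<lambda>\<theta>. norm (g (\<rho> * cis \<theta>)) powr p"
  have nz': "g (\<rho> * cis \<theta>) \<noteq> 0" for \<theta> using \<rho>0 by (intro nz) (simp add: norm_mult)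
  have cont: "continuous_on {0..2*pi} ?f"
    by (intro continuous_on_powr continuous_intros continuous_on_circle[OF hol \<rho>0 \<rho>]) (use nz' in auto)
  have int: "?f integrable_on {0..2*pi}" by (rule integrable_continuous_real[OF cont])
  have I: "integral {0..2*pi} ?f \<le> 2 * pi * ?N"
  proof -
    have "ennreal (integral {0..2*pi} ?f) = (\<integral>\<^sup>+\<theta>. ennreal (indicator {0..2*pi} \<theta> * ?f \<theta>) \<partial>lborel)"
      by (rule nn_integral_has_integral_lebesgue[OF _ integrable_integral[OF int], symmetric]) simp
    also have "\<dots> = (\<integral>\<^sup>+\<theta>\<in>{0..2*pi}. ennreal (?f \<theta>) \<partial>lborel)"
      by (intro nn_integral_cong) (auto simp: indicator_def)
    also have "\<dots> \<le> ennreal (2 * pi * ?N)" by (rule hardy_circle_le[OF g \<rho>0 \<rho>])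
    finally show ?thesis by (simp add: ennreal_le_iff)
  qed
  have "norm (g w) powr p \<le> integral {0..2*pi} (\<lambda>t. poisson_kernel \<rho> w t * ?f t)"
    by (rule powr_norm_le_poisson_integral[OF hol \<rho> nz w1(1) p])
  also have "\<dots> \<le> integral {0..2*pi} (\<lambda>t. 4 / pi / (1 - norm w) * ?f t)"
  proof (rule integral_le)
    show "(\<lambda>t. poisson_kernel \<rho> w t * ?f t) integrable_on {0..2*pi}"
      by (intro integrable_continuous_real continuous_on_mult continuous_on_poisson_kernel w1 cont)
    show "(\<lambda>t. 4 / pi / (1 - norm w) * ?f t) integrable_on {0..2*pi}"
      by (intro integrable_continuous_real continuous_on_mult cont) auto
  qed (intro mult_right_mono poisson_kernel_le w \<rho>; simp)
  also have "\<dots> = 4 / pi / (1 - norm w) * integral {0..2*pi} ?f" by (rule integral_mult_right)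
  also have "\<dots> \<le> 4 / pi / (1 - norm w) * (2 * pi * ?N)"
    using w1 by (intro mult_left_mono I) auto
  also have "\<dots> = 8 * ?N / (1 - norm w)" by simp
  finally show ?thesis .
qed

text \<open>The boundary values enter through f = |g|^(p/2), which is square integrable, and the cap
  in the minimum is the pointwise bound for u = |g(w)|^(p/2). In the constant 8 / pi, a factor 2
  comes from absorbing u / 2 and 4 / pi from the kernel bound. The right-hand side is a single
  integral over the circle, ready for exchange with the integral against the measure.\<close>

lemma hardy_truncated_le:
  assumes g: "in_hardy_disc p g" and p: "0 < p" and s: "1 < s" and w: "norm w \<le> 2 * \<rho> - 1" and \<rho>: "\<rho> < 1"
    and nz: "\<And>z. norm z = \<rho> \<Longrightarrow> g z \<noteq> 0" and N: "N = enn2real (hardy_disc_pnorm p g)" "0 < N"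
  shows "ennreal (norm (g w) powr (s * p)) \<le> (\<integral>\<^sup>+\<theta>. indicator {0..2*pi} \<theta> *
      ennreal (8 / pi * (norm (g (\<rho> * cis \<theta>)) powr (p / 2) *
        (min (2 * norm (g (\<rho> * cis \<theta>)) powr (p / 2)) (sqrt (8 * N / (1 - norm w))) powr (2 * s - 1) *
         (1 - norm w))) * (1 / (norm (cis \<theta> - w))\<^sup>2)) \<partial>lborel)"
proof (cases "g w = 0")
  case False
  have w1: "norm w < \<rho>" "norm w < 1" using w \<rho> by auto
  have \<rho>0: "0 < \<rho>" using w1 norm_ge_zero[of w] by linarith
  have hol: "g holomorphic_on ball 0 1" using g by (simp add: in_hardy_disc_def)
  define f where "f = (\<lambda>\<theta>. norm (g (\<rho> * cis \<theta>)) powr (p / 2))"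
  define u where "u = norm (g w) powr (p / 2)"
  have u: "0 < u" using False by (simp add: u_def)
  define M where "M = sqrt (8 * N / (1 - norm w))"
  have M: "0 < M" using N w1 by (simp add: M_def)
  define m where "m = (\<lambda>\<theta>. min (2 * f \<theta>) M powr (2 * s - 1))"
  have nz': "g (\<rho> * cis \<theta>) \<noteq> 0" for \<theta> using \<rho>0 by (intro nz) (simp add: norm_mult)
  have fpos: "0 < f \<theta>" for \<theta> using nz' by (simp add: f_def)
  have contf: "continuous_on A f" for A
    unfolding f_def
    by (intro continuous_on_powr continuous_intros continuous_on_circle[OF hol \<rho>0 \<rho>]) (use nz' in auto)
  have contm: "continuous_on A m" for A
    unfolding m_def by (intro continuous_on_powr continuous_intros contf) (use less_imp_neq[OF fpos, symmetric] M in \<open>auto simp: min_def\<close>)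
  have u2: "u\<^sup>2 = norm (g w) powr p" using False by (simp add: u_def power2_eq_square flip: powr_add)
  have uM: "u \<le> M"
    unfolding M_def N(1) by (rule real_le_rsqrt) (use hardy_pointwise_le[OF g p w \<rho> nz] u2 in simp)
  \<comment> \<open>A Marcinkiewicz-type truncation of \<open>f\<close> at height \<open>u / 2\<close>, kept continuous by using \<open>m\<close> in place of an indicator.\<close>
  have pt: "f \<theta> \<le> f \<theta> * m \<theta> / u powr (2 * s - 1) + u / 2" for \<theta>
  proof (cases "u \<le> 2 * f \<theta>")
    case True
    then have "u powr (2 * s - 1) \<le> m \<theta>"
      unfolding m_def using uM u s by (intro powr_mono2) auto
    then have "f \<theta> * u powr (2 * s - 1) \<le> f \<theta> * m \<theta>" using fpos by (intro mult_left_mono) (auto intro: less_imp_le)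
    then have "f \<theta> \<le> f \<theta> * m \<theta> / u powr (2 * s - 1)" using u by (simp add: field_simps)
    then show ?thesis using u by linarith
  next
    case False
    have "0 \<le> f \<theta> * m \<theta> / u powr (2 * s - 1)" using fpos[of \<theta>] by (simp add: m_def)
    then show ?thesis using False by linarith
  qed
  let ?k = "poisson_kernel \<rho> w"
  note contk = continuous_on_poisson_kernel[OF w1(1)]
  have int2: "(\<lambda>t. ?k t * (f t * m t)) integrable_on {0..2*pi}"
    by (intro integrable_continuous_real continuous_on_mult contk contf contm)
  have "u \<le> integral {0..2*pi} (\<lambda>t. ?k t * f t)"
    unfolding u_def f_def by (rule powr_norm_le_poisson_integral[OF hol \<rho> nz w1(1)]) (use p in auto)
  also have "\<dots> \<le> integral {0..2*pi} (\<lambda>t. ?k t * (f t * m t) * (1 / u powr (2 * s - 1)) + ?k t * (u / 2))"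
  proof (rule integral_le)
    show "(\<lambda>t. ?k t * f t) integrable_on {0..2*pi}"
      by (intro integrable_continuous_real continuous_on_mult contk contf)
    show "(\<lambda>t. ?k t * (f t * m t) * (1 / u powr (2 * s - 1)) + ?k t * (u / 2)) integrable_on {0..2*pi}"
      by (intro integrable_continuous_real continuous_on_add continuous_on_mult contk contf contm continuous_on_const)
    show "?k t * f t \<le> ?k t * (f t * m t) * (1 / u powr (2 * s - 1)) + ?k t * (u / 2)" for t
      using mult_left_mono[OF pt poisson_kernel_nonneg[OF w1(1)]] by (simp add: distrib_left)
  qed
  also have "\<dots> = integral {0..2*pi} (\<lambda>t. ?k t * (f t * m t)) * (1 / u powr (2 * s - 1)) + 1 * (u / 2)"
    by (rule integral_unique, intro has_integral_add has_integral_mult_left poisson_kernel_integral[OF w1(1)] integrable_integral int2)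
  \<comment> \<open>The kernel has mass 1, so the part of \<open>f\<close> below u / 2 contributes u
    / 2, which moves to the left. Multiplying by u^(2s-1) then makes the left side u^(2s) =
    |g(w)|^(sp).\<close>
  finally have "u \<le> 2 * integral {0..2*pi} (\<lambda>t. ?k t * (f t * m t)) * (1 / u powr (2 * s - 1))" by simp
  then have "u * u powr (2 * s - 1) \<le> 2 * integral {0..2*pi} (\<lambda>t. ?k t * (f t * m t))"
    using u by (simp add: field_simps)
  also have "u * u powr (2 * s - 1) = norm (g w) powr (s * p)"
  proof -
    have "u * u powr (2 * s - 1) = u powr (2 * s)" using u powr_add[of u 1 "2 * s - 1"] by simp
    also have "\<dots> = norm (g w) powr (s * p)" unfolding u_def powr_powr by (simp add: mult_ac)
    finally show ?thesis .
  qed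
  finally have le: "norm (g w) powr (s * p) \<le> 2 * integral {0..2*pi} (\<lambda>t. ?k t * (f t * m t))" .
  have hi: "((\<lambda>t. 2 * (?k t * (f t * m t))) has_integral 2 * integral {0..2*pi} (\<lambda>t. ?k t * (f t * m t))) {0..2*pi}"
    by (intro has_integral_mult_right integrable_integral int2)
  have "ennreal (norm (g w) powr (s * p)) \<le> ennreal (2 * integral {0..2*pi} (\<lambda>t. ?k t * (f t * m t)))"
    using le by (rule ennreal_leI)
  also have "\<dots> = (\<integral>\<^sup>+\<theta>. ennreal (indicator {0..2*pi} \<theta> * (2 * (?k \<theta> * (f \<theta> * m \<theta>)))) \<partial>lborel)"
    by (rule nn_integral_has_integral_lebesgue[OF _ hi, symmetric])
       (use poisson_kernel_nonneg[OF w1(1)] less_imp_le[OF fpos] in \<open>auto simp: m_def intro!: mult_nonneg_nonneg\<close>)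
  also have "\<dots> \<le> (\<integral>\<^sup>+\<theta>. indicator {0..2*pi} \<theta> *
      ennreal (8 / pi * (f \<theta> * (m \<theta> * (1 - norm w))) * (1 / (norm (cis \<theta> - w))\<^sup>2)) \<partial>lborel)"
  proof (rule nn_integral_mono)
    fix \<theta> :: real
    have "2 * (?k \<theta> * (f \<theta> * m \<theta>)) \<le> 2 * ((4 / pi * (1 - norm w) / (norm (cis \<theta> - w))\<^sup>2) * (f \<theta> * m \<theta>))"
      using fpos[of \<theta>] by (intro mult_left_mono mult_right_mono poisson_kernel_le w \<rho>) (auto simp: m_def)
    also have "\<dots> = 8 / pi * (f \<theta> * (m \<theta> * (1 - norm w))) * (1 / (norm (cis \<theta> - w))\<^sup>2)" by (simp add: field_simps)
    finally show "ennreal (indicator {0..2*pi} \<theta> * (2 * (?k \<theta> * (f \<theta> * m \<theta>)))) \<le> indicator {0..2*pi} \<theta> *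
      ennreal (8 / pi * (f \<theta> * (m \<theta> * (1 - norm w))) * (1 / (norm (cis \<theta> - w))\<^sup>2))"
      by (auto simp: indicator_def intro!: ennreal_leI)
  qed
  finally show ?thesis unfolding f_def m_def M_def .
qed (use p s in simp)

lemma geometric_annulus_index:
  fixes l t :: real
  assumes "0 < l" "l < 1" "0 < t" "t \<le> 1"
  obtains n where "l * l ^ n < t" "t \<le> l ^ n"
proof -
  define n where "n = (LEAST n. l ^ Suc n < t)"
  have "\<exists>n. l ^ n < t" using real_arch_pow_inv[of t l] assms by blast
  then obtain k where "l ^ k < t" by blast
  then have "l ^ Suc k < t" using assms by (smt (verit) power_Suc_less_one mult_left_le_one_le power_Suc zero_le_power)
  then have 1: "l ^ Suc n < t" unfolding n_def by (rule LeastI)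
  have 2: "t \<le> l ^ n"
  \<comment> \<open>Minimality of \<open>n\<close> gives the bound for a successor; for n = 0 it is
    the hypothesis t \<le> 1.\<close>
  proof (cases n)
    case (Suc k)
    then show ?thesis using not_less_Least[of k "\<lambda>n. l ^ Suc n < t"] unfolding n_def by auto
  qed (use assms in simp)
  show ?thesis using that[of n] 1 2 by simp
qed

text \<open>Integrate \<open>hardy_truncated_le\<close>, exchange the integrals, and for fixed
  \<theta> split the disc into annuli of ratio l = 1 - \<kappa> / 4, the width allowed by
  \<open>annulus_poisson_integral_le\<close>. The constant does not depend on \<open>\<rho>\<close>,
  so the inner disc can later be exhausted to the whole disc.\<close>

lemma hardy_integral_inner_disc_le:
  fixes \<nu> :: "complex measure"
  assumes sets: "sets \<nu> = sets (restrict_space borel (ball 0 1))"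
    and \<kappa>: "0 < \<kappa>" "\<kappa> < 1" and c: "0 < c" and bound: "whitney_bound \<kappa> s c \<nu>"
    and g: "in_hardy_disc p g" and p: "0 < p" and s: "1 < s" and \<rho>: "\<rho> < 1" "1 / 2 < \<rho>"
    and nz: "\<And>z. norm z = \<rho> \<Longrightarrow> g z \<noteq> 0" and N: "N = enn2real (hardy_disc_pnorm p g)" "0 < N"
    and l: "l = 1 - \<kappa> / 4"
  shows "(\<integral>\<^sup>+w. indicator (cball 0 (2 * \<rho> - 1)) w * ennreal (norm (g w) powr (s * p)) \<partial>\<nu>)
    \<le> ennreal (8 / pi * (256 * pi\<^sup>2 * c / (3 * \<kappa>\<^sup>2)) *
        (2 * (8 / l) powr (s - 1) * (1 / (1 - sqrt l) + 1 / (1 - l powr (s - 1)))) * (2 * pi) * N powr s)"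
proof -
  have l01: "0 < l" "l < 1" using \<kappa> l by auto
  \<comment> \<open>On the annulus of index n, 1 - |w| exceeds l * l^n; the additional 1 / l is put
    into \<open>A\<close>, so the cap there is at most sqrt (A / l^n).\<close>
  define A where "A = 8 * N / l"
  have A: "0 < A" using N l01 by (simp add: A_def)
  define C1 where "C1 = 256 * pi\<^sup>2 * c / (3 * \<kappa>\<^sup>2)"
  have C1: "0 < C1" using c \<kappa> by (simp add: C1_def)
  define D where "D = 1 / (1 - sqrt l) + 1 / (1 - l powr (s - 1))"
  have D: "0 \<le> D" using l01 s powr_less_mono2[of "s - 1" l 1] by (auto simp: D_def intro!: add_nonneg_nonneg)
  define f where "f = (\<lambda>\<theta>. norm (g (\<rho> * cis \<theta>)) powr (p / 2))"
  have hol: "g holomorphic_on ball 0 1" using g by (simp add: in_hardy_disc_def)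
  have nz': "g (\<rho> * cis \<theta>) \<noteq> 0" for \<theta> using \<rho> by (intro nz) (simp add: norm_mult)
  have fpos: "0 < f \<theta>" for \<theta> using nz' by (simp add: f_def)
  have f2: "f \<theta> * f \<theta> = norm (g (\<rho> * cis \<theta>)) powr p" for \<theta>
    using nz' by (simp add: f_def flip: powr_add)
  have "continuous_on UNIV f"
    unfolding f_def by (intro continuous_on_powr continuous_intros continuous_on_circle[OF hol]) (use nz' \<rho> in auto)
  then have [measurable]: "f \<in> borel_measurable borel" by (rule borel_measurable_continuous_onI)
  have [measurable]: "cis \<in> borel_measurable borel"
    by (intro borel_measurable_continuous_onI continuous_intros)
  have space: "space \<nu> = ball 0 1" using sets_eq_imp_space_eq[OF sets] by (simp add: space_restrict_space)
  have id: "(\<lambda>w. w) \<in> \<nu> \<rightarrow>\<^sub>M borel"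
    unfolding measurable_cong_sets[OF sets refl] by (rule measurable_restrict_space1) simp
  define H where "H = (\<lambda>w \<theta>. indicator (cball 0 (2 * \<rho> - 1)) w * (indicator {0..2*pi} \<theta> *
      ennreal (8 / pi * (f \<theta> * (min (2 * f \<theta>) (sqrt (8 * N / (1 - norm w))) powr (2 * s - 1) *
         (1 - norm w))) * (1 / (norm (cis \<theta> - w))\<^sup>2))))"
  \<comment> \<open>Joint measurability is proved on the full Borel product and then pulled back
    along the inclusion of the disc.\<close>
  have "(\<lambda>x. H (fst x) (snd x)) \<in> borel_measurable (borel \<Otimes>\<^sub>M borel)"
  proof -
    have 1: "(\<lambda>x. indicator (cball 0 (2 * \<rho> - 1)) (fst x) :: ennreal) \<in> borel_measurable (borel \<Otimes>\<^sub>M (borel :: real measure))"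
      by (rule measurable_compose[OF measurable_fst]) (simp add: borel_measurable_indicator)
    have 2: "(\<lambda>x. indicator {0..2*pi} (snd x) :: ennreal) \<in> borel_measurable ((borel :: complex measure) \<Otimes>\<^sub>M borel)"
      by (rule measurable_compose[OF measurable_snd]) (simp add: borel_measurable_indicator)
    have 3: "(\<lambda>x. f (snd x)) \<in> borel_measurable ((borel :: complex measure) \<Otimes>\<^sub>M borel)"
      "(\<lambda>x. cis (snd x)) \<in> borel_measurable ((borel :: complex measure) \<Otimes>\<^sub>M borel)"
      by (rule measurable_compose[OF measurable_snd], measurable)+
    show ?thesis
      unfolding H_def using 3
      by (intro borel_measurable_times_ennreal 1 2 measurable_compose[OF _ measurable_ennreal] borel_measurable_times
          powr_real_measurable borel_measurable_min borel_measurable_diff borel_measurable_divide borel_measurable_power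
          measurable_compose[OF _ borel_measurable_sqrt] measurable_compose[OF _ borel_measurable_norm] borel_measurable_const measurable_fst)
  qed
  moreover have "(\<lambda>x. (fst x, snd x)) \<in> \<nu> \<Otimes>\<^sub>M lborel \<rightarrow>\<^sub>M borel \<Otimes>\<^sub>M borel"
    by (intro measurable_Pair measurable_compose[OF measurable_fst id]) (auto simp: measurable_lborel2)
  ultimately have "(\<lambda>x. H (fst (fst x, snd x)) (snd (fst x, snd x))) \<in> borel_measurable (\<nu> \<Otimes>\<^sub>M lborel)"
    by (rule measurable_compose[rotated])
  then have H_meas: "(\<lambda>(w, \<theta>). H w \<theta>) \<in> borel_measurable (\<nu> \<Otimes>\<^sub>M lborel)"
    by (simp add: case_prod_beta')
  interpret S: sigma_finite_measure \<nu> by (rule sigma_finite_of_whitney_bound[OF sets \<kappa> bound])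
  interpret P: pair_sigma_finite \<nu> lborel
    by (intro pair_sigma_finite.intro S.sigma_finite_measure_axioms sigma_finite_lborel)
  have inner: "(\<integral>\<^sup>+w. H w \<theta> \<partial>\<nu>) \<le> ennreal (8 / pi * C1 * (2 * A powr (s - 1) * D)) *
      (ennreal (norm (g (\<rho> * cis \<theta>)) powr p) * indicator {0..2*pi} \<theta>)" for \<theta>
  proof (cases "\<theta> \<in> {0..2*pi}")
    case True
    define y where "y = f \<theta>"
    have y: "0 < y" using fpos by (simp add: y_def)
    define mm where "mm = (\<lambda>n. min (2 * y) (sqrt (A / l ^ n)) powr (2 * s - 1))"
    have mm0: "0 \<le> mm n" for n by (simp add: mm_def)
    define X where "X = (\<lambda>n w. indicator {w. (1 - \<kappa> / 4) * l ^ n < 1 - norm w \<and> 1 - norm w \<le> l ^ n} w *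
        ennreal (1 / (norm (cis \<theta> - w))\<^sup>2))"
    have X_meas: "X n \<in> borel_measurable \<nu>" for n
      unfolding X_def by (rule measurable_compose[OF id]) measurable
    have "H w \<theta> \<le> (\<Sum>n. ennreal (8 / pi * (y * (mm n * l ^ n))) * X n w)" if "w \<in> space \<nu>" for w
    proof -
      define t where "t = 1 - norm w"
      have t: "0 < t" "t \<le> 1" using that space by (auto simp: t_def)
      obtain n where n: "l * l ^ n < t" "t \<le> l ^ n" using geometric_annulus_index[OF l01 t] .
      have "min (2 * y) (sqrt (8 * N / t)) powr (2 * s - 1) \<le> mm n"
      proof -
        have "8 * N / t \<le> 8 * N / (l * l ^ n)"
          using n t N l01 by (intro divide_left_mono mult_pos_pos) auto
        also have "\<dots> = A / l ^ n" by (simp add: A_def)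
        finally have "sqrt (8 * N / t) \<le> sqrt (A / l ^ n)" by simp
        then show ?thesis unfolding mm_def using y s t N
          by (intro powr_mono2) (auto simp: min_le_iff_disj)
      qed
      then have le: "8 / pi * (y * (min (2 * y) (sqrt (8 * N / t)) powr (2 * s - 1) * t)) \<le> 8 / pi * (y * (mm n * l ^ n))"
        using n(2) t y mm0 by (intro mult_left_mono mult_mono) auto
      have "H w \<theta> \<le> ennreal (8 / pi * (y * (min (2 * y) (sqrt (8 * N / t)) powr (2 * s - 1) * t)) * (1 / (norm (cis \<theta> - w))\<^sup>2))"
        unfolding H_def y_def[symmetric] t_def[symmetric] by (auto simp: indicator_def)
      also have "\<dots> \<le> ennreal (8 / pi * (y * (mm n * l ^ n)) * (1 / (norm (cis \<theta> - w))\<^sup>2))"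
        by (intro ennreal_leI mult_right_mono le) auto
      also have "\<dots> = ennreal (8 / pi * (y * (mm n * l ^ n))) * X n w"
        using n y mm0[of n] l01 by (subst ennreal_mult) (auto simp: X_def indicator_def t_def l)
      also have "\<dots> = (\<Sum>i\<in>{n}. ennreal (8 / pi * (y * (mm i * l ^ i))) * X i w)" by simp
      also have "\<dots> \<le> (\<Sum>n. ennreal (8 / pi * (y * (mm n * l ^ n))) * X n w)"
        by (rule sum_le_suminf) auto
      finally show ?thesis .
    qed
    then have "(\<integral>\<^sup>+w. H w \<theta> \<partial>\<nu>) \<le> (\<integral>\<^sup>+w. (\<Sum>n. ennreal (8 / pi * (y * (mm n * l ^ n))) * X n w) \<partial>\<nu>)"
      by (rule nn_integral_mono)
    also have "\<dots> = (\<Sum>n. ennreal (8 / pi * (y * (mm n * l ^ n))) * (\<integral>\<^sup>+w. X n w \<partial>\<nu>))"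
      using X_meas by (subst nn_integral_suminf) (auto simp: nn_integral_cmult)
    also have "\<dots> \<le> (\<Sum>n. ennreal (8 / pi * (y * (mm n * l ^ n))) * ennreal (C1 * (l ^ n) powr (s - 2)))"
    proof (intro suminf_le mult_left_mono)
      fix n
      show "(\<integral>\<^sup>+w. X n w \<partial>\<nu>) \<le> ennreal (C1 * (l ^ n) powr (s - 2))"
        unfolding X_def C1_def
        by (rule annulus_poisson_integral_le[OF sets \<kappa> c bound]) (use l01 in \<open>auto simp: power_le_one\<close>)
    qed auto
    \<comment> \<open>The factor l^n bounding 1 - |w| and the annulus bound (l^n)^(s - 2) combine to
      (l^n)^(s - 1), the weight in \<open>sum_min_powr_le\<close>.\<close>
    also have "\<dots> = (\<Sum>n. ennreal (8 / pi * y * C1 * (mm n * (l ^ n) powr (s - 1))))"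
    proof (intro suminf_cong)
      fix n
      have "(l ^ n) powr (s - 1) = l ^ n * (l ^ n) powr (s - 2)"
        using l01 powr_add[of "l ^ n" 1 "s - 2"] by simp
      then have "8 / pi * y * C1 * (mm n * (l ^ n) powr (s - 1)) = (8 / pi * (y * (mm n * l ^ n))) * (C1 * (l ^ n) powr (s - 2))"
        by simp
      also have "ennreal \<dots> = ennreal (8 / pi * (y * (mm n * l ^ n))) * ennreal (C1 * (l ^ n) powr (s - 2))"
        using y mm0[of n] l01 C1 by (intro ennreal_mult) auto
      finally show "ennreal (8 / pi * (y * (mm n * l ^ n))) * ennreal (C1 * (l ^ n) powr (s - 2)) =
        ennreal (8 / pi * y * C1 * (mm n * (l ^ n) powr (s - 1)))" by simp
    qed
    \<comment> \<open>All partial sums have the same bound. It carries a second factor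
      \<open>y\<close>, so y^2 = |g|^p appears and the remaining integral is the Hardy mean.\<close>
    also have "\<dots> \<le> ennreal (8 / pi * y * C1 * (2 * y * A powr (s - 1) * D))"
      unfolding suminf_eq_SUP
    proof (rule SUP_least)
      fix k :: nat
      have "(\<Sum>n<k. ennreal (8 / pi * y * C1 * (mm n * (l ^ n) powr (s - 1)))) =
          ennreal (\<Sum>n<k. 8 / pi * y * C1 * (mm n * (l ^ n) powr (s - 1)))"
        using y mm0 C1 by (intro sum_ennreal) auto
      also have "\<dots> = ennreal (8 / pi * y * C1 * (\<Sum>n<k. mm n * (l ^ n) powr (s - 1)))"
        by (simp only: sum_distrib_left)
      also have "\<dots> \<le> ennreal (8 / pi * y * C1 * (2 * y * A powr (s - 1) * D))"
        using y C1 unfolding mm_def D_def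
        by (intro ennreal_leI mult_left_mono sum_min_powr_le l01 s A) auto
      finally show "(\<Sum>n<k. ennreal (8 / pi * y * C1 * (mm n * (l ^ n) powr (s - 1)))) \<le> \<dots>" .
    qed
    also have "8 / pi * y * C1 * (2 * y * A powr (s - 1) * D) = (8 / pi * C1 * (2 * A powr (s - 1) * D)) * (y * y)"
      by (simp add: mult_ac)
    also have "ennreal \<dots> = ennreal (8 / pi * C1 * (2 * A powr (s - 1) * D)) * ennreal (y * y)"
      using C1 D by (intro ennreal_mult) auto
    finally show ?thesis using True by (simp add: y_def f2)
  qed (simp add: H_def)
  have "(\<integral>\<^sup>+w. indicator (cball 0 (2 * \<rho> - 1)) w * ennreal (norm (g w) powr (s * p)) \<partial>\<nu>)
      \<le> (\<integral>\<^sup>+w. (\<integral>\<^sup>+\<theta>. H w \<theta> \<partial>lborel) \<partial>\<nu>)"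
  proof (rule nn_integral_mono)
    fix w
    show "indicator (cball 0 (2 * \<rho> - 1)) w * ennreal (norm (g w) powr (s * p)) \<le> (\<integral>\<^sup>+\<theta>. H w \<theta> \<partial>lborel)"
    proof (cases "w \<in> cball 0 (2 * \<rho> - 1)")
      case True
      then show ?thesis
        using hardy_truncated_le[OF g p s _ \<rho>(1) nz N, of w] by (simp add: H_def f_def)
    qed simp
  qed
  also have "\<dots> = (\<integral>\<^sup>+\<theta>. (\<integral>\<^sup>+w. H w \<theta> \<partial>\<nu>) \<partial>lborel)"
    by (rule P.Fubini'[OF H_meas, symmetric])
  also have "\<dots> \<le> (\<integral>\<^sup>+\<theta>. ennreal (8 / pi * C1 * (2 * A powr (s - 1) * D)) *
      (ennreal (norm (g (\<rho> * cis \<theta>)) powr p) * indicator {0..2*pi} \<theta>) \<partial>lborel)"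
    by (intro nn_integral_mono inner)
  also have "\<dots> = ennreal (8 / pi * C1 * (2 * A powr (s - 1) * D)) *
      (\<integral>\<^sup>+\<theta>\<in>{0..2*pi}. ennreal (norm (g (\<rho> * cis \<theta>)) powr p) \<partial>lborel)"
    unfolding f2[symmetric] by (rule nn_integral_cmult) measurable
  also have "\<dots> \<le> ennreal (8 / pi * C1 * (2 * A powr (s - 1) * D)) * ennreal (2 * pi * N)"
    using hardy_circle_le[OF g, of \<rho>] \<rho> unfolding N(1) by (intro mult_left_mono) auto
  also have "\<dots> = ennreal (8 / pi * C1 * (2 * A powr (s - 1) * D) * (2 * pi * N))"
    using C1 D N by (intro ennreal_mult[symmetric]) auto
  \<comment> \<open>\<open>A\<close> is proportional to N, so A^(s - 1) N is a multiple of N^s, the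
    homogeneity of the Carleson inequality.\<close>
  also have "8 / pi * C1 * (2 * A powr (s - 1) * D) * (2 * pi * N) =
      8 / pi * C1 * (2 * (8 / l) powr (s - 1) * D) * (2 * pi) * N powr s"
  proof -
    have "A powr (s - 1) = (8 / l) powr (s - 1) * N powr (s - 1)"
      using N l01 powr_mult[of "8 / l" N "s - 1"] by (simp add: A_def)
    moreover have "N powr s = N powr (s - 1) * N"
      using N powr_add[of N "s - 1" 1] by simp
    ultimately show ?thesis by simp
  qed
  finally show ?thesis unfolding C1_def D_def .
qed

text \<open>For each radius r < 1 there is a zero-free circle with r \<le> 2 \<rho> - 1, so the
  inner estimate covers the disc of radius r with a uniform constant; monotone convergence
  finishes.\<close>

lemma carleson_disc_of_whitney_bound:
  fixes \<nu> :: "complex measure"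
  assumes sets: "sets \<nu> = sets (restrict_space borel (ball 0 1))"
    and \<kappa>: "0 < \<kappa>" "\<kappa> < 1" and c: "0 < c" and bound: "whitney_bound \<kappa> (q / p) c \<nu>"
    and p: "0 < p" and q: "p < q"
  shows "carleson_disc p q \<nu>"
proof -
  define s where "s = q / p"
  have s: "1 < s" "s * p = q" using p q by (auto simp: s_def)
  define l where "l = 1 - \<kappa> / 4"
  have l01: "0 < l" "l < 1" using \<kappa> l_def by auto
  define K where "K = 8 / pi * (256 * pi\<^sup>2 * c / (3 * \<kappa>\<^sup>2)) *
        (2 * (8 / l) powr (s - 1) * (1 / (1 - sqrt l) + 1 / (1 - l powr (s - 1)))) * (2 * pi)"
  have "0 < 1 / (1 - sqrt l) + 1 / (1 - l powr (s - 1))"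
    using l01 s powr_less_mono2[of "s - 1" l 1] by (intro add_pos_pos) auto
  then have K: "0 < K" unfolding K_def using c \<kappa> l01 by (intro mult_pos_pos) auto
  have space: "space \<nu> = ball 0 1" using sets_eq_imp_space_eq[OF sets] by (simp add: space_restrict_space)
  have main: "(\<integral>\<^sup>+w. ennreal (norm (g w) powr q) \<partial>\<nu>) \<le>
      ennreal ((K powr (1 / q) * enn2real (hardy_disc_pnorm p g) powr (1 / p)) powr q)"
    if g: "in_hardy_disc p g" for g
  proof -
    define N where "N = enn2real (hardy_disc_pnorm p g)"
    have hol: "g holomorphic_on ball 0 1" using g by (simp add: in_hardy_disc_def)
    \<comment> \<open>This identity dictates the choice K^(1/q) for the Carleson constant.\<close>
    have rhs: "(K powr (1 / q) * N powr (1 / p)) powr q = K * N powr s"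
      using K p q by (simp add: powr_mult powr_powr s_def)
    show ?thesis
    proof (cases "\<exists>z\<in>ball 0 1. g z \<noteq> 0")
      case False
      then have "(\<integral>\<^sup>+w. ennreal (norm (g w) powr q) \<partial>\<nu>) = (\<integral>\<^sup>+w. 0 \<partial>\<nu>)"
        using space by (intro nn_integral_cong) auto
      then show ?thesis by simp
    next
      case True
      have circ: "\<exists>\<rho>. r \<le> 2 * \<rho> - 1 \<and> 1 / 2 < \<rho> \<and> \<rho> < 1 \<and> (\<forall>z. norm z = \<rho> \<longrightarrow> g z \<noteq> 0)" if "0 \<le> r" "r < 1" for r
      proof -
        obtain \<rho> where "(1 + r) / 2 < \<rho>" "\<rho> < 1" "\<And>z. norm z = \<rho> \<Longrightarrow> g z \<noteq> 0"
          using exists_zero_free_circle[OF hol True, of "(1 + r) / 2"] \<open>0 \<le> r\<close> \<open>r < 1\<close> by auto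
        then show ?thesis using \<open>0 \<le> r\<close> by (intro exI[of _ \<rho>]) auto
      qed
      \<comment> \<open>With N = 0 the pointwise estimate would force g(z) = 0 at a point where it
        is not.\<close>
      have N: "0 < N"
      proof (rule ccontr)
        assume "\<not> 0 < N"
        then have "N = 0" using enn2real_nonneg[of "hardy_disc_pnorm p g"] by (simp add: N_def)
        obtain z where z: "norm z < 1" "g z \<noteq> 0" using True by auto
        obtain \<rho> where "norm z \<le> 2 * \<rho> - 1" "\<rho> < 1" "\<And>z. norm z = \<rho> \<Longrightarrow> g z \<noteq> 0"
          using circ[of "norm z"] z by auto
        from hardy_pointwise_le[OF g p this] show False
          using z \<open>N = 0\<close> by (simp add: N_def)
      qed
      define r where "r = (\<lambda>n::nat. 1 - 1 / (real n + 1))"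
      have r01: "0 \<le> r n" "r n < 1" for n by (auto simp: r_def)
      have le: "(\<integral>\<^sup>+w. indicator (cball 0 (r n)) w * ennreal (norm (g w) powr q) \<partial>\<nu>) \<le> ennreal (K * N powr s)" for n
      proof -
        obtain \<rho> where \<rho>: "r n \<le> 2 * \<rho> - 1" "\<rho> < 1" "1 / 2 < \<rho>" "\<And>z. norm z = \<rho> \<Longrightarrow> g z \<noteq> 0"
          using circ[OF r01] by auto
        have "(\<integral>\<^sup>+w. indicator (cball 0 (r n)) w * ennreal (norm (g w) powr q) \<partial>\<nu>) \<le>
          (\<integral>\<^sup>+w. indicator (cball 0 (2 * \<rho> - 1)) w * ennreal (norm (g w) powr (s * p)) \<partial>\<nu>)"
          using \<rho>(1) unfolding s(2) by (intro nn_integral_mono mult_right_mono) (auto simp: indicator_def)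
        also have "\<dots> \<le> ennreal (K * N powr s)"
          unfolding K_def
          by (rule hardy_integral_inner_disc_le[OF sets \<kappa> c _ g p s(1) \<rho>(2,3,4) N_def N l_def])
             (use bound in \<open>simp_all add: s_def\<close>)
        finally show ?thesis .
      qed
      have id: "(\<lambda>w. w) \<in> \<nu> \<rightarrow>\<^sub>M borel"
        unfolding measurable_cong_sets[OF sets refl] by (rule measurable_restrict_space1) simp
      have g_meas: "g \<in> borel_measurable \<nu>"
        unfolding measurable_cong_sets[OF sets refl]
        by (rule borel_measurable_continuous_on_restrict[OF holomorphic_on_imp_continuous_on[OF hol]])
      have "(\<integral>\<^sup>+w. ennreal (norm (g w) powr q) \<partial>\<nu>) =
        (\<integral>\<^sup>+w. (SUP n. indicator (cball 0 (r n)) w * ennreal (norm (g w) powr q)) \<partial>\<nu>)"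
      proof (rule nn_integral_cong)
        fix w assume "w \<in> space \<nu>"
        then have w: "norm w < 1" using space by simp
        obtain n where "1 / (real n + 1) < 1 - norm w"
          using nat_approx_posE[of "1 - norm w"] w by (metis diff_gt_0_iff_gt of_nat_Suc add.commute)
        then have n: "w \<in> cball 0 (r n)" by (simp add: r_def)
        show "ennreal (norm (g w) powr q) = (SUP n. indicator (cball 0 (r n)) w * ennreal (norm (g w) powr q))"
        proof (rule antisym)
          have "ennreal (norm (g w) powr q) = indicator (cball 0 (r n)) w * ennreal (norm (g w) powr q)"
            using n by simp
          also have "\<dots> \<le> (SUP n. indicator (cball 0 (r n)) w * ennreal (norm (g w) powr q))"
            by (rule SUP_upper) simp
          finally show "ennreal (norm (g w) powr q) \<le> \<dots>" .
          show "(SUP n. indicator (cball 0 (r n)) w * ennreal (norm (g w) powr q)) \<le> ennreal (norm (g w) powr q)"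
            by (rule SUP_least) (simp add: indicator_def)
        qed
      qed
      also have "\<dots> = (SUP n. \<integral>\<^sup>+w. indicator (cball 0 (r n)) w * ennreal (norm (g w) powr q) \<partial>\<nu>)"
      proof (rule nn_integral_monotone_convergence_SUP)
        show "incseq (\<lambda>n w. indicator (cball 0 (r n)) w * ennreal (norm (g w) powr q))"
        proof (intro incseq_SucI le_funI mult_right_mono)
          fix n w
          have "r n \<le> r (Suc n)" by (simp add: r_def field_simps)
          then show "indicator (cball 0 (r n)) w \<le> (indicator (cball 0 (r (Suc n))) w :: ennreal)"
            by (auto simp: indicator_def)
        qed auto
        fix n
        have "(\<lambda>w. indicator (cball 0 (r n)) w :: ennreal) \<in> borel_measurable \<nu>"
          by (rule measurable_compose[OF id]) (simp add: borel_measurable_indicator)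
        then show "(\<lambda>w. indicator (cball 0 (r n)) w * ennreal (norm (g w) powr q)) \<in> borel_measurable \<nu>"
          using g_meas by measurable
      qed
      also have "\<dots> \<le> ennreal (K * N powr s)"
        by (rule SUP_least) (rule le)
      finally show ?thesis using rhs unfolding N_def by simp
    qed
  qed
  show ?thesis
    unfolding carleson_disc_def using main K by (intro exI[of _ "K powr (1 / q)"]) auto
qed

section \<open>Transfer to the domain\<close>

text \<open>The p-th root of a normalised squared kernel. On the circle of radius r its p-th power
  is at most 2 pi times the Poisson kernel at r a, whose integral is 1, so the norm is at most 1
  whatever \<open>a\<close> is.\<close>

lemma hardy_test_function:
  assumes a: "norm a < 1" and p: "0 < p"
  obtains g where "in_hardy_disc p g" "hardy_disc_pnorm p g \<le> 1"
    "\<And>w. norm w < 1 \<Longrightarrow> norm (g w) = ((1 - (norm a)\<^sup>2) / (norm (1 - cnj a * w))\<^sup>2) powr (1 / p)"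
proof -
  define A where "A = 1 - (norm a)\<^sup>2"
  have A: "0 < A" using a by (simp add: A_def power_less_one_iff)
  have lt: "norm (cnj a * w) < 1" if "norm w < 1" for w
    using a that mult_strict_mono'[of "norm a" 1 "norm w" 1] by (simp add: norm_mult)
  \<comment> \<open>The values have positive real part, so the principal logarithm defines the
    root.\<close>
  have nonpos: "1 - cnj a * w \<notin> \<real>\<^sub>\<le>\<^sub>0" if "norm w < 1" for w
  proof -
    have "Re (cnj a * w) < 1" using lt[OF that] complex_Re_le_cmod[of "cnj a * w"] by linarith
    then show ?thesis by (auto simp: complex_nonpos_Reals_iff)
  qed
  define g where "g = (\<lambda>w. of_real (A powr (1 / p)) * exp (of_real (- 2 / p) * Ln (1 - cnj a * w)))"
  have hol: "g holomorphic_on ball 0 1"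
    unfolding g_def by (intro holomorphic_intros) (use nonpos in auto)
  have ng: "norm (g w) = (A / (norm (1 - cnj a * w))\<^sup>2) powr (1 / p)" if w: "norm w < 1" for w
  proof -
    have nz: "1 - cnj a * w \<noteq> 0" using nonpos[OF w] by auto
    then have "norm (exp (of_real (- 2 / p) * Ln (1 - cnj a * w))) = exp (- 2 / p * ln (norm (1 - cnj a * w)))"
      by (simp add: norm_exp_eq_Re)
    also have "\<dots> = norm (1 - cnj a * w) powr (- 2 / p)" using nz by (simp add: powr_def)
    also have "\<dots> = 1 / ((norm (1 - cnj a * w))\<^sup>2) powr (1 / p)"
    proof -
      have "(norm (1 - cnj a * w))\<^sup>2 = norm (1 - cnj a * w) powr 2" using nz by simp
      then show ?thesis by (simp only: powr_powr) (simp add: powr_minus_divide)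
    qed
    finally show ?thesis using A by (simp add: g_def norm_mult powr_divide)
  qed
  have pn: "hardy_disc_pnorm p g \<le> 1"
    unfolding hardy_disc_pnorm_def
  proof (rule SUP_least)
    fix r :: real assume "r \<in> {0<..<1}"
    then have r: "0 < r" "r < 1" by auto
    have ra: "norm (of_real r * a) < 1" using a r mult_strict_mono'[of r 1 "norm a" 1] by (simp add: norm_mult)
    have pt: "norm (g (of_real r * cis \<theta>)) powr p \<le> 2 * pi * poisson_kernel 1 (of_real r * a) \<theta>" for \<theta>
    proof -
      have "norm (1 - cnj a * (of_real r * cis \<theta>)) = norm (cnj (1 - cnj a * (of_real r * cis \<theta>)))" by (rule complex_mod_cnj[symmetric])
      also have "cnj (1 - cnj a * (of_real r * cis \<theta>)) = cis (- \<theta>) * (cis \<theta> - of_real r * a)"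
        by (simp add: algebra_simps cis_mult cis_cnj)
      also have "norm \<dots> = norm (cis \<theta> - of_real r * a)" by (simp add: norm_mult)
      finally have eq: "norm (1 - cnj a * (of_real r * cis \<theta>)) = norm (cis \<theta> - of_real r * a)" .
      have "norm (g (of_real r * cis \<theta>)) powr p = A / (norm (cis \<theta> - of_real r * a))\<^sup>2"
        using ng[of "of_real r * cis \<theta>"] r p A unfolding eq by (simp add: norm_mult powr_powr)
      \<comment> \<open>Since |r a| \<le> |a|, enlarging the numerator makes it that of the Poisson
        kernel at r a.\<close>
      also have "\<dots> \<le> (1\<^sup>2 - (norm (of_real r * a))\<^sup>2) / (norm (cis \<theta> - of_real r * a))\<^sup>2"
        using r by (intro divide_right_mono) (auto simp: A_def norm_mult power_mult_distrib mult_left_le_one_le power_le_one)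
      also have "\<dots> = 2 * pi * poisson_kernel 1 (of_real r * a) \<theta>"
        by (simp add: poisson_kernel_def)
      finally show ?thesis .
    qed
    have "(\<integral>\<^sup>+\<theta>\<in>{0..2*pi}. ennreal (norm (g (of_real r * cis \<theta>)) powr p) \<partial>lborel)
      \<le> (\<integral>\<^sup>+\<theta>. ennreal (indicator {0..2*pi} \<theta> * (2 * pi * poisson_kernel 1 (of_real r * a) \<theta>)) \<partial>lborel)"
      by (intro nn_integral_mono) (auto simp: indicator_def intro!: ennreal_leI pt)
    also have "\<dots> = ennreal (2 * pi * 1)"
      by (rule nn_integral_has_integral_lebesgue[OF _ has_integral_mult_right[OF poisson_kernel_integral[OF ra]]])
         (use poisson_kernel_nonneg[OF ra] in simp)
    finally have "ennreal (1 / (2 * pi)) * (\<integral>\<^sup>+\<theta>\<in>{0..2*pi}. ennreal (norm (g (of_real r * cis \<theta>)) powr p) \<partial>lborel)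
        \<le> ennreal (1 / (2 * pi)) * ennreal (2 * pi * 1)"
      by (rule mult_left_mono) simp
    also have "\<dots> = 1" by (simp add: ennreal_mult[symmetric])
    finally show "ennreal (1 / (2 * pi)) * (\<integral>\<^sup>+\<theta>\<in>{0..2*pi}. ennreal (norm (g (of_real r * cis \<theta>)) powr p) \<partial>lborel) \<le> 1" .
  qed
  then have "in_hardy_disc p g"
    using hol by (auto simp: in_hardy_disc_def intro: le_less_trans)
  then show ?thesis using that[of g] pn ng by (simp add: A_def)
qed

section \<open>The pullback measure and the two implications\<close>

context conformal_disc
begin

lemma deriv_phi_continuous: "continuous_on (ball 0 1) (deriv \<phi>)"
  by (intro holomorphic_on_imp_continuous_on holomorphic_deriv hol open_ball)

lemma psi_measurable:
  assumes "sets \<mu> = sets (restrict_space borel \<Omega>)"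
  shows "\<psi> \<in> \<mu> \<rightarrow>\<^sub>M restrict_space borel (ball 0 1)"
  unfolding measurable_cong_sets[OF assms refl]
  by (rule measurable_restrict_space2)
     (use psi_in psi_hol in \<open>auto simp: space_restrict_space intro!: borel_measurable_continuous_on_restrict holomorphic_on_imp_continuous_on\<close>)

text \<open>Images under \<open>\<phi>\<close> are preimages under \<open>\<psi>\<close>, so the
  pullback is a push-forward along a measurable map and the change of variables for
  \<open>distr\<close> applies.\<close>

lemma pullback_eq_distr:
  assumes sets: "sets \<mu> = sets (restrict_space borel \<Omega>)"
  shows "pullback \<phi> \<mu> = distr \<mu> (restrict_space borel (ball 0 1)) \<psi>"
proof -
  let ?D = "restrict_space borel (ball 0 1) :: complex measure"
  have space: "space \<mu> = \<Omega>" using sets_eq_imp_space_eq[OF sets] by (simp add: space_restrict_space)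
  have spD: "space ?D = ball 0 1" by (simp add: space_restrict_space)
  have "measure_of (space ?D) (sets ?D) (\<lambda>E. emeasure \<mu> (\<phi> ` E)) =
      measure_of (space ?D) (sets ?D) (\<lambda>E. emeasure \<mu> (\<psi> -` E \<inter> space \<mu>))"
  proof (rule measure_of_eq)
    fix E assume "E \<in> sigma_sets (space ?D) (sets ?D)"
    then have E: "E \<subseteq> ball 0 1"
      using sets.sets_into_space[of E ?D] spD by (metis sets.sigma_sets_eq)
    have "\<phi> ` E = \<psi> -` E \<inter> space \<mu>"
    proof
      show "\<phi> ` E \<subseteq> \<psi> -` E \<inter> space \<mu>" using E psi_phi phi_in space by auto
      show "\<psi> -` E \<inter> space \<mu> \<subseteq> \<phi> ` E" using phi_psi space by (auto intro!: image_eqI[of _ \<phi>])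
    qed
    then show "emeasure \<mu> (\<phi> ` E) = emeasure \<mu> (\<psi> -` E \<inter> space \<mu>)" by simp
  qed (rule sets.space_closed)
  then show ?thesis by (simp add: pullback_def distr_def spD)
qed

lemma sets_carleson_nu:
  assumes "sets \<mu> = sets (restrict_space borel \<Omega>)"
  shows "sets (carleson_nu p q \<phi> \<mu>) = sets (restrict_space borel (ball 0 1))"
  by (simp add: carleson_nu_def pullback_eq_distr[OF assms])

lemma nn_integral_carleson_nu:
  assumes sets: "sets \<mu> = sets (restrict_space borel \<Omega>)"
    and F: "F \<in> borel_measurable (restrict_space borel (ball 0 1))"
  shows "(\<integral>\<^sup>+w. F w \<partial>carleson_nu p q \<phi> \<mu>) =
    (\<integral>\<^sup>+z. ennreal (norm (deriv \<phi> (\<psi> z)) powr (- q / p)) * F (\<psi> z) \<partial>\<mu>)"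
proof -
  let ?D = "restrict_space borel (ball 0 1) :: complex measure"
  have [measurable]: "deriv \<phi> \<in> borel_measurable ?D"
    by (rule borel_measurable_continuous_on_restrict[OF deriv_phi_continuous])
  have h: "(\<lambda>w. ennreal (norm (deriv \<phi> w) powr (- q / p))) \<in> borel_measurable ?D" by measurable
  have "(\<integral>\<^sup>+w. F w \<partial>carleson_nu p q \<phi> \<mu>) =
      (\<integral>\<^sup>+w. ennreal (norm (deriv \<phi> w) powr (- q / p)) * F w \<partial>distr \<mu> ?D \<psi>)"
    unfolding carleson_nu_def pullback_eq_distr[OF sets]
    by (rule nn_integral_density) (use h F in auto)
  also have "\<dots> = (\<integral>\<^sup>+z. ennreal (norm (deriv \<phi> (\<psi> z)) powr (- q / p)) * F (\<psi> z) \<partial>\<mu>)"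
    by (rule nn_integral_distr[OF psi_measurable[OF sets]]) (use h F in \<open>auto intro!: borel_measurable_times_ennreal\<close>)
  finally show ?thesis .
qed

text \<open>\<open>\<phi>\<close> sends the small ball into the Whitney ball of radius
  \<open>\<delta> z / 2\<close>. There |\<phi>'| is at least \<delta>(z) / (48 pi d) with d = 1 -
  |w|, so the density is at most (48 pi d / \<delta>(z))^s. Multiplied by the Whitney bound c
  (\<delta>(z) / 2)^s this leaves c (24 pi d)^s.\<close>

lemma whitney_bound_carleson_nu:
  assumes sets: "sets \<mu> = sets (restrict_space borel \<Omega>)"
    and p: "0 < p" and q: "p < q" and c0: "0 < c0" "c0 \<le> 1 / 2" and c: "0 < c"
    and W: "\<And>z r. whitney_ball c0 \<Omega> z r \<Longrightarrow> emeasure \<mu> (ball z r) \<le> ennreal (c * r powr (q / p))"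
  shows "whitney_bound (1 / (288 * pi\<^sup>2)) (q / p) (c * (24 * pi) powr (q / p)) (carleson_nu p q \<phi> \<mu>)"
  unfolding whitney_bound_def
proof (intro allI impI)
  fix w :: complex assume w: "norm w < 1"
  define s where "s = q / p"
  have s: "0 < s" using p q by (simp add: s_def)
  let ?\<kappa> = "1 / (288 * pi\<^sup>2)" let ?B = "ball w (?\<kappa> * (1 - norm w))"
  define d where "d = 1 - norm w"
  have d: "0 < d" using w by (simp add: d_def)
  define z where "z = \<phi> w"
  have z: "z \<in> \<Omega>" using phi_in w by (simp add: z_def)
  have \<delta>: "0 < \<delta> z" using delta_pos z by simp
  have \<kappa>1: "?\<kappa> \<le> 1"
  proof -
    have "1 \<le> pi\<^sup>2" using pi_gt3 by (intro one_le_power) auto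
    then show ?thesis by simp
  qed
  have Bsub: "?B \<subseteq> ball 0 1"
    using mult_right_mono[OF \<kappa>1, of "1 - norm w"] w by (simp add: ball_subset_ball_iff)
  have B_sets: "?B \<in> sets (restrict_space borel (ball 0 1))"
    using Bsub by (auto simp: sets_restrict_space_iff)
  have half_sub: "ball z (\<delta> z / 2) \<subseteq> \<Omega>"
    using ball_bdist_subset[OF z] \<delta> by (rule_tac order_trans[OF subset_ball]) auto
  have space: "space \<mu> = \<Omega>" using sets_eq_imp_space_eq[OF sets] by (simp add: space_restrict_space)
  have half_sets: "ball z (\<delta> z / 2) \<in> sets \<mu>"
    unfolding sets using half_sub open_dom by (auto simp: sets_restrict_space_iff)
  have pt: "ennreal (norm (deriv \<phi> (\<psi> x)) powr (- q / p)) * indicator ?B (\<psi> x) \<le>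
      ennreal ((\<delta> z / (48 * pi * d)) powr (- s)) * indicator (ball z (\<delta> z / 2)) x" if x: "x \<in> space \<mu>" for x
  proof (cases "\<psi> x \<in> ?B")
    case True
    define v where "v = \<psi> x"
    have v: "norm v < 1" "\<phi> v = x" using x psi_in phi_psi space by (auto simp: v_def)
    have xb: "x \<in> ball z (\<delta> z / 2)"
    proof -
      have "v \<in> ball w ((1 - norm w) / (288 * pi\<^sup>2))" using True by (simp add: v_def)
      then show ?thesis using phi_image_small_ball[OF w] v(2) unfolding z_def by blast
    qed
    have "\<delta> z \<le> \<delta> x + dist z x" by (rule bdist_triangle)
    then have dx: "\<delta> z / 2 \<le> \<delta> x" using xb by simp
    have "norm w - norm v \<le> norm (w - v)" by (rule norm_triangle_ineq2)
    also have "\<dots> \<le> ?\<kappa> * (1 - norm w)" using True by (simp add: v_def dist_norm)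
    also have "\<dots> \<le> 1 * (1 - norm w)" using \<kappa>1 w by (intro mult_right_mono) auto
    finally have dv: "1 - norm v \<le> 2 * d" by (simp add: d_def)
    have "\<delta> x \<le> 12 * pi * ((1 - norm v) * norm (deriv \<phi> v))"
      using deriv_phi_lower[OF v(1)] v(2) by simp
    also have "\<dots> \<le> 12 * pi * (2 * d * norm (deriv \<phi> v))"
      using dv by (intro mult_left_mono mult_right_mono) auto
    \<comment> \<open>Combines \<delta>(z) / 2 \<le> \<delta>(x) with \<delta>(x) \<le> 24 pi d
      |\<phi>'(v)|; hence 48. The exponent - s then turns this lower bound into an upper bound for
      the density.\<close>
    finally have "\<delta> z / (48 * pi * d) \<le> norm (deriv \<phi> v)"
      using dx d by (simp add: field_simps)
    then have "norm (deriv \<phi> v) powr (- s) \<le> (\<delta> z / (48 * pi * d)) powr (- s)"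
      using s \<delta> d by (intro powr_mono2') auto
    then show ?thesis
      using True xb by (simp add: v_def s_def ennreal_leI)
  qed simp
  have "emeasure (carleson_nu p q \<phi> \<mu>) ?B = (\<integral>\<^sup>+v. indicator ?B v \<partial>carleson_nu p q \<phi> \<mu>)"
    using B_sets by (subst nn_integral_indicator) (auto simp: sets_carleson_nu[OF sets])
  also have "\<dots> = (\<integral>\<^sup>+x. ennreal (norm (deriv \<phi> (\<psi> x)) powr (- q / p)) * indicator ?B (\<psi> x) \<partial>\<mu>)"
    by (rule nn_integral_carleson_nu[OF sets]) (use B_sets in \<open>rule borel_measurable_indicator\<close>)
  also have "\<dots> \<le> (\<integral>\<^sup>+x. ennreal ((\<delta> z / (48 * pi * d)) powr (- s)) * indicator (ball z (\<delta> z / 2)) x \<partial>\<mu>)"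
    by (rule nn_integral_mono) (rule pt)
  also have "\<dots> = ennreal ((\<delta> z / (48 * pi * d)) powr (- s)) * emeasure \<mu> (ball z (\<delta> z / 2))"
    by (rule nn_integral_cmult_indicator[OF half_sets])
  also have "\<dots> \<le> ennreal ((\<delta> z / (48 * pi * d)) powr (- s)) * ennreal (c * (\<delta> z / 2) powr s)"
  proof (rule mult_left_mono)
    \<comment> \<open>The largest admissible radius is used; it meets the lower requirement because
      c0 \<le> 1/2.\<close>
    have "whitney_ball c0 \<Omega> z (\<delta> z / 2)"
      unfolding whitney_ball_def using z half_sub mult_right_mono[OF c0(2), of "\<delta> z"] \<delta> by simp
    then show "emeasure \<mu> (ball z (\<delta> z / 2)) \<le> ennreal (c * (\<delta> z / 2) powr s)"
      unfolding s_def by (rule W)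
  qed simp
  also have "\<dots> = ennreal ((\<delta> z / (48 * pi * d)) powr (- s) * (c * (\<delta> z / 2) powr s))"
    using c by (intro ennreal_mult[symmetric]) auto
  also have "(\<delta> z / (48 * pi * d)) powr (- s) * (c * (\<delta> z / 2) powr s) = c * (24 * pi) powr s * d powr s"
  proof -
    have "(\<delta> z / (48 * pi * d)) powr (- s) = ((48 * pi * d) / \<delta> z) powr s"
      using \<delta> d by (simp add: powr_minus powr_divide)
    then have "(\<delta> z / (48 * pi * d)) powr (- s) * (c * (\<delta> z / 2) powr s) = c * (((48 * pi * d) / \<delta> z) powr s * (\<delta> z / 2) powr s)"
      by simp
    also have "((48 * pi * d) / \<delta> z) powr s * (\<delta> z / 2) powr s = (((48 * pi * d) / \<delta> z) * (\<delta> z / 2)) powr s"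
      by (rule powr_mult[symmetric])
    also have "((48 * pi * d) / \<delta> z) * (\<delta> z / 2) = (24 * pi) * d" using \<delta> by simp
    also have "\<dots> powr s = (24 * pi) powr s * d powr s" by (rule powr_mult)
    finally show ?thesis by simp
  qed
  finally show "emeasure (carleson_nu p q \<phi> \<mu>) ?B \<le> ennreal (c * (24 * pi) powr (q / p) * (1 - norm w) powr (q / p))"
    by (simp add: s_def d_def)
qed

text \<open>Test with the kernel at a = \<open>\<psi> z\<close>. On the ball, with d = 1 - |a|, the
  density is at least (72 pi \<delta>(z) / d)^(-s) and |g|^q at least (1 / (16 d))^s; in the product
  d cancels and (1152 pi \<delta>(z))^(-s) remains.\<close>

lemma whitney_ball_le_of_carleson:
  assumes sets: "sets \<mu> = sets (restrict_space borel \<Omega>)"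
    and p: "0 < p" and q: "p < q" and c0: "0 < c0" and C: "0 < C"
    and carl: "\<And>g. in_hardy_disc p g \<Longrightarrow> (\<integral>\<^sup>+w. ennreal (norm (g w) powr q) \<partial>carleson_nu p q \<phi> \<mu>)
        \<le> ennreal ((C * enn2real (hardy_disc_pnorm p g) powr (1 / p)) powr q)"
    and W: "whitney_ball c0 \<Omega> z r"
  shows "emeasure \<mu> (ball z r) \<le> ennreal (C powr q * (1152 * pi / c0) powr (q / p) * r powr (q / p))"
proof -
  define s where "s = q / p"
  have s: "0 < s" using p q by (simp add: s_def)
  have z: "z \<in> \<Omega>" and r: "c0 * \<delta> z \<le> r" "r \<le> \<delta> z / 2" and sub: "ball z r \<subseteq> \<Omega>"
    using W by (auto simp: whitney_ball_def)
  have \<delta>: "0 < \<delta> z" using delta_pos z by simp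
  define a where "a = \<psi> z"
  have a: "norm a < 1" using psi_in z by (simp add: a_def)
  define d where "d = 1 - norm a"
  have d: "0 < d" using a by (simp add: d_def)
  obtain g where g: "in_hardy_disc p g" "hardy_disc_pnorm p g \<le> 1"
    "\<And>w. norm w < 1 \<Longrightarrow> norm (g w) = ((1 - (norm a)\<^sup>2) / (norm (1 - cnj a * w))\<^sup>2) powr (1 / p)"
    using hardy_test_function[OF a p] by blast
  have ball_sets: "ball z r \<in> sets \<mu>"
    unfolding sets using sub open_dom by (auto simp: sets_restrict_space_iff)
  have pt: "ennreal ((1152 * pi * \<delta> z) powr (- s)) * indicator (ball z r) x \<le>
      ennreal (norm (deriv \<phi> (\<psi> x)) powr (- q / p)) * ennreal (norm (g (\<psi> x)) powr q)" for x
  proof (cases "x \<in> ball z r")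
    case True
    then have xb: "x \<in> ball z (\<delta> z / 2)" and xO: "x \<in> \<Omega>" using r sub by auto
    define v where "v = \<psi> x"
    have v: "norm v < 1" "\<phi> v = x" using psi_in phi_psi xO by (auto simp: v_def)
    have n1: "norm (1 - cnj a * v) \<le> 4 * d" and n2: "d \<le> 4 * (1 - norm v)"
      using psi_half_ball[OF z xb] by (auto simp: a_def v_def d_def)
    have dx: "\<delta> x \<le> 3 / 2 * \<delta> z"
      using bdist_triangle[of \<Omega> x z] xb by (simp add: dist_commute)
    have "d / 4 * norm (deriv \<phi> v) \<le> (1 - norm v) * norm (deriv \<phi> v)"
      using n2 by (intro mult_right_mono) auto
    also have "\<dots> \<le> 12 * pi * \<delta> x" using deriv_phi_upper[OF v(1)] v(2) by simp
    also have "\<dots> \<le> 12 * pi * (3 / 2 * \<delta> z)" using dx by (intro mult_left_mono) auto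
    \<comment> \<open>72 is 12 from the Koebe bound, 3/2 from \<delta>(x) \<le> 3/2 \<delta>(z), and
      4 from comparing 1 - |v| with d.\<close>
    finally have "norm (deriv \<phi> v) \<le> 72 * pi * \<delta> z / d" using d by (simp add: field_simps)
    then have h: "(72 * pi * \<delta> z / d) powr (- s) \<le> norm (deriv \<phi> v) powr (- s)"
      using s deriv_phi_nz[OF v(1)] by (intro powr_mono2') auto
    have lt: "norm (cnj a * v) < 1"
      using a v mult_strict_mono'[of "norm a" 1 "norm v" 1] by (simp add: norm_mult)
    then have pos: "0 < norm (1 - cnj a * v)" by force
    \<comment> \<open>From \<open>psi_half_ball\<close>: the kernel's denominator is at most (4 d)^2
      and its numerator is at least d.\<close>
    have "1 / (16 * d) = d / (4 * d)\<^sup>2" using d by (simp add: power2_eq_square)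
    also have "\<dots> \<le> (1 - (norm a)\<^sup>2) / (norm (1 - cnj a * v))\<^sup>2"
    proof (rule frac_le)
      have "norm a * norm a \<le> 1 * norm a" using a by (intro mult_right_mono) auto
      then show "d \<le> 1 - (norm a)\<^sup>2" by (simp add: d_def power2_eq_square)
      then show "0 \<le> 1 - (norm a)\<^sup>2" using d by linarith
      show "(norm (1 - cnj a * v))\<^sup>2 \<le> (4 * d)\<^sup>2" using n1 by (intro power_mono) auto
      show "0 < (norm (1 - cnj a * v))\<^sup>2" using pos by simp
    qed
    finally have "(1 / (16 * d)) powr s \<le> ((1 - (norm a)\<^sup>2) / (norm (1 - cnj a * v))\<^sup>2) powr s"
      using s d by (intro powr_mono2) auto
    also have "\<dots> = norm (g v) powr q"
      unfolding g(3)[OF v(1)] powr_powr by (simp add: s_def)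
    finally have gv: "(1 / (16 * d)) powr s \<le> norm (g v) powr q" .
    have "(1152 * pi * \<delta> z) powr (- s) = (72 * pi * \<delta> z / d) powr (- s) * (1 / (16 * d)) powr s"
    proof -
      have "(1 / (16 * d)) powr s = (16 * d) powr (- s)"
        using d by (simp add: powr_minus powr_divide inverse_eq_divide)
      moreover have "(72 * pi * \<delta> z / d) powr (- s) * (16 * d) powr (- s) = (72 * pi * \<delta> z / d * (16 * d)) powr (- s)"
        by (rule powr_mult[symmetric])
      moreover have "72 * pi * \<delta> z / d * (16 * d) = 1152 * pi * \<delta> z" using d by simp
      ultimately show ?thesis by (simp only:)
    qed
    also have "\<dots> \<le> norm (deriv \<phi> v) powr (- s) * norm (g v) powr q"
      using h gv by (intro mult_mono) auto
    finally have "ennreal ((1152 * pi * \<delta> z) powr (- s)) \<le> ennreal (norm (deriv \<phi> v) powr (- s) * norm (g v) powr q)"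
      by (rule ennreal_leI)
    also have "\<dots> = ennreal (norm (deriv \<phi> v) powr (- s)) * ennreal (norm (g v) powr q)"
      by (rule ennreal_mult) auto
    finally show ?thesis using True by (simp add: v_def s_def)
  qed simp
  have hol_g: "g holomorphic_on ball 0 1" using g(1) by (simp add: in_hardy_disc_def)
  have [measurable]: "g \<in> borel_measurable (restrict_space borel (ball 0 1))"
    by (rule borel_measurable_continuous_on_restrict[OF holomorphic_on_imp_continuous_on[OF hol_g]])
  let ?K = "1152 * pi * \<delta> z"
  have "ennreal (?K powr (- s)) * emeasure \<mu> (ball z r) = (\<integral>\<^sup>+x. ennreal (?K powr (- s)) * indicator (ball z r) x \<partial>\<mu>)"
    by (rule nn_integral_cmult_indicator[OF ball_sets, symmetric])
  also have "\<dots> \<le> (\<integral>\<^sup>+x. ennreal (norm (deriv \<phi> (\<psi> x)) powr (- q / p)) * ennreal (norm (g (\<psi> x)) powr q) \<partial>\<mu>)"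
    by (rule nn_integral_mono) (rule pt)
  also have "\<dots> = (\<integral>\<^sup>+w. ennreal (norm (g w) powr q) \<partial>carleson_nu p q \<phi> \<mu>)"
    by (rule nn_integral_carleson_nu[OF sets, symmetric]) measurable
  also have "\<dots> \<le> ennreal ((C * enn2real (hardy_disc_pnorm p g) powr (1 / p)) powr q)"
    by (rule carl[OF g(1)])
  also have "\<dots> \<le> ennreal (C powr q)"
  proof (intro ennreal_leI powr_mono2)
    have "enn2real (hardy_disc_pnorm p g) \<le> 1" using enn2real_mono[OF g(2)] by simp
    then have "enn2real (hardy_disc_pnorm p g) powr (1 / p) \<le> 1" using p by (intro powr_le1) auto
    then show "C * enn2real (hardy_disc_pnorm p g) powr (1 / p) \<le> C" using C by simp
  qed (use p q C in auto)
  finally have "ennreal (?K powr s) * (ennreal (?K powr (- s)) * emeasure \<mu> (ball z r)) \<le> ennreal (?K powr s) * ennreal (C powr q)"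
    by (rule mult_left_mono) simp
  also have "ennreal (?K powr s) * (ennreal (?K powr (- s)) * emeasure \<mu> (ball z r)) = emeasure \<mu> (ball z r)"
    using \<delta> by (simp add: mult.assoc[symmetric] ennreal_mult[symmetric] powr_add[symmetric])
  also have "ennreal (?K powr s) * ennreal (C powr q) = ennreal (C powr q * ?K powr s)"
    by (simp add: ennreal_mult[symmetric] mult.commute)
  also have "\<dots> \<le> ennreal (C powr q * ((1152 * pi / c0) powr s * r powr s))"
  proof (intro ennreal_leI mult_left_mono)
    \<comment> \<open>The lower radius bound c0 \<delta>(z) \<le> r trades \<delta>(z) for r; this
      is where the constant depends on \<open>c0\<close>.\<close>
    have "?K \<le> 1152 * pi / c0 * r"
      using r(1) c0 mult_left_mono[of "\<delta> z" "r / c0" "1152 * pi"] by (simp add: field_simps)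
    then have "?K powr s \<le> (1152 * pi / c0 * r) powr s" using \<delta> s by (intro powr_mono2) auto
    also have "\<dots> = (1152 * pi / c0) powr s * r powr s" by (rule powr_mult)
    finally show "?K powr s \<le> (1152 * pi / c0) powr s * r powr s" .
  qed auto
  finally show ?thesis by (simp add: s_def mult.assoc)
qed

end

theorem theorem1:
  fixes \<Omega> :: "complex set" and \<mu> :: "complex measure" and \<phi> :: "complex \<Rightarrow> complex"
    and p q c0 :: real
  assumes "open \<Omega>" and "connected \<Omega>" and "simply_connected \<Omega>" and "bounded \<Omega>"
    and "\<Omega> \<noteq> {}"
    and "sets \<mu> = sets (restrict_space borel \<Omega>)"
    and "\<phi> holomorphic_on ball 0 1" and "bij_betw \<phi> (ball 0 1) \<Omega>"
    and "0 < p" and "p < q"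
    and "0 < c0" and "c0 \<le> 1 / 2"
  shows "carleson_domain p q \<phi> \<mu> \<longleftrightarrow>
    (\<exists>c>0. \<forall>z r. whitney_ball c0 \<Omega> z r \<longrightarrow>
        emeasure \<mu> (ball z r) \<le> ennreal (c * r powr (q / p)))"
proof -
  interpret conformal_disc \<Omega> \<phi>
    by unfold_locales (use assms in auto)
  show ?thesis
  proof
    assume "carleson_domain p q \<phi> \<mu>"
    then obtain C where C: "0 < C" "\<And>g. in_hardy_disc p g \<Longrightarrow> (\<integral>\<^sup>+w. ennreal (norm (g w) powr q) \<partial>carleson_nu p q \<phi> \<mu>)
        \<le> ennreal ((C * enn2real (hardy_disc_pnorm p g) powr (1 / p)) powr q)"
      unfolding carleson_domain_def carleson_disc_def by blast
    have "0 < C powr q * (1152 * pi / c0) powr (q / p)" using C(1) assms by simp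
    moreover have "emeasure \<mu> (ball z r) \<le> ennreal (C powr q * (1152 * pi / c0) powr (q / p) * r powr (q / p))"
      if "whitney_ball c0 \<Omega> z r" for z r
      by (rule whitney_ball_le_of_carleson[OF assms(6,9,10,11) C that])
    ultimately show "\<exists>c>0. \<forall>z r. whitney_ball c0 \<Omega> z r \<longrightarrow> emeasure \<mu> (ball z r) \<le> ennreal (c * r powr (q / p))"
      by blast
  next
    assume "\<exists>c>0. \<forall>z r. whitney_ball c0 \<Omega> z r \<longrightarrow> emeasure \<mu> (ball z r) \<le> ennreal (c * r powr (q / p))"
    then obtain c where c: "0 < c"
      "\<And>z r. whitney_ball c0 \<Omega> z r \<Longrightarrow> emeasure \<mu> (ball z r) \<le> ennreal (c * r powr (q / p))" by blast
    \<comment> \<open>The disc estimate requires its parameter \<kappa>, here 1 / (288 pi^2), to be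
      below 1.\<close>
    have "1 < pi\<^sup>2" using pi_gt3 by (intro one_less_power) auto
    then have "1 / (288 * pi\<^sup>2) < 1" by simp
    then show "carleson_domain p q \<phi> \<mu>"
      unfolding carleson_domain_def
      by (intro carleson_disc_of_whitney_bound[OF sets_carleson_nu[OF assms(6)] _ _ _
            whitney_bound_carleson_nu[OF assms(6,9,10,11,12) c] assms(9,10)])
         (use c(1) in auto)
  qed
qed

end
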